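(* Let $\phi$ be an orientation-preserving isometry of a spin, closed, hyperbolic $4$-manifold $M=\Gamma\backslash H^4$, and let $\hat\phi$ be a lift of $\phi$ to a symmetry of a spin structure $\hat\Gamma\backslash\mathrm{SU}(1,1;\mathbb H)$ on $M$. Let $P$ be an isolated fixed point of $\phi$, and let $x=(x_1,\dots,x_5)\in H^4$ with $\Gamma x=P$. Let $\Phi$ be the unique element of $\mathrm{SO}^+(4,1)$ such that $\phi=\Phi_\star$ and $\Phi x=x$, and let $\hat\Phi\in\mathrm{SU}(1,1;\mathbb H)$ be the lift of $\Phi$ such that $\hat\phi=\hat\Phi_\star$. Then $$\nu(\hat\phi,P)=\frac{x_5}{2(\mathrm{Re}(\hat\Phi_{11})-\mathrm{Re}(\hat\Phi_{22}))}.$$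
   Context: $\mathrm{SU}(1,1;\mathbb H)=\{A\in\mathbb H(2):A^*JA=J\}$, $J=\mathrm{diag}(1,-1)$, acts on $B^4=\{q\in\mathbb H:|q|<1\}$ by $\begin{pmatrix}a&b\\c&d\end{pmatrix}\cdot q=(aq+b)(cq+d)^{-1}$. Identify $q_0+q_1\mathbf i+q_2\mathbf j+q_3\mathbf k$ with $(q_0,\dots,q_3)\in\mathbb R^4$, let $H^4=\{x\in\mathbb R^5: x_1^2+\dots+x_4^2-x_5^2=-1,\ x_5>0\}$ and $\zeta:B^4\to H^4$, $\zeta(y)=(2y/(1-|y|^2),(1+|y|^2)/(1-|y|^2))$. The double covering epimorphism $\eta:\mathrm{SU}(1,1;\mathbb H)\to\mathrm{SO}^+(4,1)$ is characterized by $\zeta(A\cdot y)=\eta(A)\zeta(y)$. $\Gamma\subset\mathrm{SO}^+(4,1)$ is discrete and torsion-free with $M$ closed, and $\hat\Gamma\subset\mathrm{SU}(1,1;\mathbb H)$ maps isomorphically onto $\Gamma$. Isometries $f_\star(\Gamma x)=\Gamma fx$ ($f$ normalizing $\Gamma$) and symmetries $\hat f_\star(\hat\Gamma\hat h)=\hat\Gamma\hat f\hat h$ ($\hat f$ normalizing $\hat\Gamma$). $\hat\Phi_{ij}$ denotes the $(i,j)$ entry. $\mathrm{Spin}(4)=\eta^{-1}(\mathrm{Stab}(e_5))=\{\mathrm{diag}(p,q):|p|=|q|=1\}$, with half-spin representations (Atiyah–Bott convention) $\Delta_4^+(\mathrm{diag}(p,q))=\Psi_1(p)$, $\Delta_4^-(\mathrm{diag}(p,q))=\Psi_1(q)$,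 where $\Psi_1(a+b\mathbf j)=\begin{pmatrix}a&b\\-\overline b&\overline a\end{pmatrix}$ for $a,b\in\mathbb C$. If $\hat\phi=\hat f_\star$ and $P=\Gamma ge_5$ with $g\in\mathrm{SO}^+(4,1)$ and $\hat g$ a lift of $g$, there is a unique $s\in\mathrm{Spin}(4)$ with $\hat\Gamma\hat f\hat g=\hat\Gamma\hat gs$, and the local contribution of $P$ to the Atiyah–Singer $G$-spin formula is $\nu(\hat\phi,P)=\dfrac{\mathrm{tr}\,\Delta_4^+(s)-\mathrm{tr}\,\Delta_4^-(s)}{|\det(I-d\phi_P)|}$. *)

theory Defs
  imports "HOL-Analysis.Analysis" "HOL-Library.Numeral_Type"
begin

section \<open>Quaternions\<close>

text \<open>A quaternion q0 + q1 i + q2 j + q3 k is identified with (q0,q1,q2,q3) in real^4,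
  index 0,1,2,3 of the numeral type 4 corresponding to q0,q1,q2,q3.\<close>

type_synonym quat = "real^4"

definition qone :: quat where "qone = axis 0 1"

definition qmul :: "quat \<Rightarrow> quat \<Rightarrow> quat" where
  "qmul a b = (\<chi> i.
     if i = 0 then a$0*b$0 - a$1*b$1 - a$2*b$2 - a$3*b$3
     else if i = 1 then a$0*b$1 + a$1*b$0 + a$2*b$3 - a$3*b$2
     else if i = 2 then a$0*b$2 - a$1*b$3 + a$2*b$0 + a$3*b$1
     else a$0*b$3 + a$1*b$2 - a$2*b$1 + a$3*b$0)"

definition qcnj :: "quat \<Rightarrow> quat" where
  "qcnj q = (\<chi> i. if i = 0 then q$0 else - q$i)"

definition qinv :: "quat \<Rightarrow> quat" where
  "qinv q = (1 / (norm q)\<^sup>2) *\<^sub>R qcnj q"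

definition qRe :: "quat \<Rightarrow> real" where "qRe q = q$0"

section \<open>2x2 quaternion matrices H(2), entries A$0$0 = A_11, A$0$1 = A_12, A$1$0 = A_21, A$1$1 = A_22\<close>

type_synonym qmat = "quat^2^2"

definition qmatmul :: "qmat \<Rightarrow> qmat \<Rightarrow> qmat" where
  "qmatmul A B = (\<chi> i j. qmul (A$i$0) (B$0$j) + qmul (A$i$1) (B$1$j))"

definition qmat_star :: "qmat \<Rightarrow> qmat" where
  "qmat_star A = (\<chi> i j. qcnj (A$j$i))"

definition qmat1 :: qmat where
  "qmat1 = (\<chi> i j. if i = j then qone else 0)"

definition Jq :: qmat where
  "Jq = (\<chi> i j. if i = j then (if i = 0 then qone else - qone) else 0)"

definition SU11H :: "qmat set" where
  "SU11H = {A. qmatmul (qmatmul (qmat_star A) Jq) A = Jq}"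

text \<open>Action on the unit ball B^4 = ball 0 1: A . q = (aq+b)(cq+d)^{-1}.\<close>
definition mob :: "qmat \<Rightarrow> quat \<Rightarrow> quat" where
  "mob A q = qmul (qmul (A$0$0) q + A$0$1) (qinv (qmul (A$1$0) q + A$1$1))"

section \<open>Hyperbolic space and SO+(4,1); index 4 of the numeral type 5 is x_5\<close>

definition H4 :: "(real^5) set" where
  "H4 = {x. (x$0)\<^sup>2 + (x$1)\<^sup>2 + (x$2)\<^sup>2 + (x$3)\<^sup>2 - (x$4)\<^sup>2 = -1 \<and> x$4 > 0}"

definition lorentz :: "real^5 \<Rightarrow> real^5 \<Rightarrow> real" where
  "lorentz x y = x$0*y$0 + x$1*y$1 + x$2*y$2 + x$3*y$3 - x$4*y$4"

definition SOp41 :: "(real^5^5) set" where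
  "SOp41 = {G. (\<forall>x y. lorentz (G *v x) (G *v y) = lorentz x y) \<and> det G = 1 \<and> G$4$4 > 0}"

definition e5 :: "real^5" where "e5 = axis 4 1"

definition zeta :: "quat \<Rightarrow> real^5" where
  "zeta y = (\<chi> i. if i = 4 then (1 + (norm y)\<^sup>2) / (1 - (norm y)\<^sup>2)
       else if i = 0 then 2 * y$0 / (1 - (norm y)\<^sup>2)
       else if i = 1 then 2 * y$1 / (1 - (norm y)\<^sup>2)
       else if i = 2 then 2 * y$2 / (1 - (norm y)\<^sup>2)
       else 2 * y$3 / (1 - (norm y)\<^sup>2))"

text \<open>Explicit inverse of zeta on H^4 (x_{1..4}/(1+x_5)), used as a chart.\<close>
definition zeta_inv :: "real^5 \<Rightarrow> quat" where
  "zeta_inv x = (\<chi> i. (if i = 0 then x$0 else if i = 1 then x$1 else if i = 2 then x$2 else x$3)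
                        / (1 + x$4))"

text \<open>The double cover eta, characterized by zeta (A . y) = eta A (zeta y).\<close>
definition eta :: "qmat \<Rightarrow> real^5^5" where
  "eta A = (THE G. G \<in> SOp41 \<and> (\<forall>y \<in> ball 0 1. zeta (mob A y) = G *v zeta y))"

section \<open>Groups, orbits, cosets\<close>

definition orbit :: "(real^5^5) set \<Rightarrow> real^5 \<Rightarrow> (real^5) set" where
  "orbit \<Gamma> x = {g *v x | g. g \<in> \<Gamma>}"

definition qcoset :: "qmat set \<Rightarrow> qmat \<Rightarrow> qmat set" where
  "qcoset \<Gamma>h h = {qmatmul \<gamma> h | \<gamma>. \<gamma> \<in> \<Gamma>h}"

definition mat_subgroup :: "(real^5^5) set \<Rightarrow> bool" where
  "mat_subgroup \<Gamma> \<longleftrightarrow> mat 1 \<in> \<Gamma> \<and> (\<forall>g\<in>\<Gamma>. \<forall>h\<in>\<Gamma>. g ** h \<in> \<Gamma>)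
      \<and> (\<forall>g\<in>\<Gamma>. invertible g \<and> matrix_inv g \<in> \<Gamma>)"

definition qmat_subgroup :: "qmat set \<Rightarrow> bool" where
  "qmat_subgroup S \<longleftrightarrow> qmat1 \<in> S \<and> (\<forall>g\<in>S. \<forall>h\<in>S. qmatmul g h \<in> S)
      \<and> (\<forall>g\<in>S. \<exists>h\<in>S. qmatmul g h = qmat1 \<and> qmatmul h g = qmat1)"

definition discrete_set :: "(real^5^5) set \<Rightarrow> bool" where
  "discrete_set \<Gamma> \<longleftrightarrow> (\<forall>g\<in>\<Gamma>. \<exists>e>0. \<forall>h\<in>\<Gamma>. dist h g < e \<longrightarrow> h = g)"

definition torsion_free :: "(real^5^5) set \<Rightarrow> bool" where
  "torsion_free \<Gamma> \<longleftrightarrow> (\<forall>g\<in>\<Gamma>. \<forall>n::nat. n > 0 \<and> (((**) g) ^^ n) (mat 1) = mat 1 \<longrightarrow> g = mat 1)"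

text \<open>M = Gamma\H^4 is compact (closed): some compact K in H^4 meets every orbit.\<close>
definition cocompact :: "(real^5^5) set \<Rightarrow> bool" where
  "cocompact \<Gamma> \<longleftrightarrow> (\<exists>K. compact K \<and> K \<subseteq> H4 \<and> H4 \<subseteq> (\<Union>g\<in>\<Gamma>. (\<lambda>v. g *v v) ` K))"

definition normalizes :: "real^5^5 \<Rightarrow> (real^5^5) set \<Rightarrow> bool" where
  "normalizes f \<Gamma> \<longleftrightarrow> invertible f \<and> (\<lambda>g. f ** g ** matrix_inv f) ` \<Gamma> = \<Gamma>"

definition qnormalizes :: "qmat \<Rightarrow> qmat set \<Rightarrow> bool" where
  "qnormalizes f S \<longleftrightarrow> (\<exists>fi. qmatmul f fi = qmat1 \<and> qmatmul fi f = qmat1 \<and>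
      (\<lambda>h. qmatmul (qmatmul f h) fi) ` S = S)"

section \<open>Spin(4), half-spin representations, local contribution nu\<close>

definition Spin4 :: "qmat set" where
  "Spin4 = {A. A$0$1 = 0 \<and> A$1$0 = 0 \<and> norm (A$0$0) = 1 \<and> norm (A$1$1) = 1}"

text \<open>Psi_1(a + b j) with a = p0 + p1 i, b = p2 + p3 i.\<close>
definition Psi1 :: "quat \<Rightarrow> complex^2^2" where
  "Psi1 p = (let a = Complex (p$0) (p$1); b = Complex (p$2) (p$3) in
     (\<chi> i j. if i = 0 then (if j = 0 then a else b) else (if j = 0 then - cnj b else cnj a)))"

definition Delta_plus :: "qmat \<Rightarrow> complex^2^2" where "Delta_plus s = Psi1 (s$0$0)"
definition Delta_minus :: "qmat \<Rightarrow> complex^2^2" where "Delta_minus s = Psi1 (s$1$1)"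

text \<open>The local contribution nu(fh_star, P) for the symmetry fh_star of the spin structure
  Gh\SU(1,1;H) over M = G\H^4, at a fixed point P (an orbit) of phi = (eta fh)_star.
  |det(I - d phi_P)| is computed in the chart of M at P given by the covering H^4 -> M
  composed with zeta: the local representative of phi is zeta_inv o Phi o zeta near
  zeta_inv x, where x = g e5 lies over P and Phi = gamma (eta fh) (gamma in G) fixes x.\<close>
definition nu :: "(real^5^5) set \<Rightarrow> qmat set \<Rightarrow> qmat \<Rightarrow> (real^5) set \<Rightarrow> complex" where
  "nu \<Gamma> \<Gamma>h fh P =
    (let g = (SOME g. g \<in> SOp41 \<and> P = orbit \<Gamma> (g *v e5));
         gh = (SOME gh. gh \<in> SU11H \<and> eta gh = g);
         s = (THE s. s \<in> Spin4 \<and> qcoset \<Gamma>h (qmatmul fh gh) = qcoset \<Gamma>h (qmatmul gh s));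
         x = g *v e5;
         \<Phi> = (SOME \<Phi>. (\<exists>\<gamma>\<in>\<Gamma>. \<Phi> = \<gamma> ** eta fh) \<and> \<Phi> *v x = x);
         D = frechet_derivative (\<lambda>y. zeta_inv (\<Phi> *v zeta y)) (at (zeta_inv x))
     in (trace (Delta_plus s) - trace (Delta_minus s))
        / complex_of_real \<bar>det (matrix (\<lambda>v. v - D v))\<bar>)"

end

theory Submission
  imports Defs
begin

text \<open>
  Writing a point of $H^4$ as the Hermitian matrix $X$ with diagonal $x_5, x_5$ and off-diagonal
  entry $q = (x_1,\dots,x_4)$, the covering $\eta$ is $X \mapsto A X A^*$. If
  $x = \eta(k) e_5$, then $\hat\Phi = k s k^{-1}$ with $s = \mathrm{diag}(p, q) \in \mathrm{Spin}(4)$;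
  freeness of the action of $\Gamma$ shows that the same $s$ computes $\nu$ whatever choices are made.
  The differential is conjugate to $v \mapsto p v \bar q$, with
  $|\det(I - d\phi_P)| = 4(\mathrm{Re} p - \mathrm{Re} q)^2$, so $\nu = 1/(2(\mathrm{Re} p - \mathrm{Re} q))$.
  Finally $\mathrm{Re} \hat\Phi_{11} - \mathrm{Re} \hat\Phi_{22} =
  (|k_{11}|^2 + |k_{12}|^2)(\mathrm{Re} p - \mathrm{Re} q)$ and $x_5 = |k_{11}|^2 + |k_{12}|^2$.
\<close>

subsection \<open>Quaternions\<close>

text \<open>The difficulty sits in the definitions more than in the formula. \<open>nu\<close> fixes
  \<open>g\<close>, its lift, \<open>s\<close> and the representative of the isometry by Hilbert
  choice or definite description, and \<open>eta\<close> is itself a definite description; each of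
  them needs existence, and \<open>s\<close> and \<open>\<Phi>\<close> need uniqueness as well. That
  an arbitrary \<open>g\<close> has a lift is surjectivity of \<open>eta\<close>, which rests on the
  quaternionic description of the isometries of R^4. Uniqueness needs trivial point stabilizers in
  \<open>\<Gamma>\<close>; discreteness and torsion-freeness give these because the stabilizer of a
  point in the Lorentz group is compact. The numerator x_5 arises because the half-spin traces are
  read off from s, while Re of the diagonal entries changes under conjugation by k: their difference
  is rescaled by the last coordinate of k e_5.\<close>

notation qmul (infixl "\<odot>" 70)

lemma exhaust_4_from_0: "x = 0 \<or> x = 1 \<or> x = 2 \<or> x = 3" for x :: 4
  using exhaust_4[of x] by auto

lemma exhaust_5_from_0: "x = 0 \<or> x = 1 \<or> x = 2 \<or> x = 3 \<or> x = 4" for x :: 5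
proof (induct x)
  case (of_int z)
  then have "z = 0 \<or> z = 1 \<or> z = 2 \<or> z = 3 \<or> z = 4" by auto
  then show ?case by auto
qed

lemma UNIV_4_from_0: "(UNIV :: 4 set) = {0, 1, 2, 3}"
  using exhaust_4_from_0 by auto

lemma UNIV_5_from_0: "(UNIV :: 5 set) = {0, 1, 2, 3, 4}"
  using exhaust_5_from_0 by auto

lemma forall_2_from_0: "(\<forall>i::2. P i) \<longleftrightarrow> P 0 \<and> P 1"
proof -
  have "x = 0 \<or> x = 1" for x :: 2 using exhaust_2[of x] by auto
  then show ?thesis by metis
qed

lemma forall_4_from_0: "(\<forall>i::4. P i) \<longleftrightarrow> P 0 \<and> P 1 \<and> P 2 \<and> P 3"
  by (metis exhaust_4_from_0)

lemma forall_5_from_0: "(\<forall>i::5. P i) \<longleftrightarrow> P 0 \<and> P 1 \<and> P 2 \<and> P 3 \<and> P 4"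
  by (metis exhaust_5_from_0)

lemma quat_eq_iff: "a = b \<longleftrightarrow> a$0 = b$0 \<and> a$1 = b$1 \<and> a$2 = b$2 \<and> a$3 = b$3" for a b :: quat
  by (simp add: vec_eq_iff forall_4_from_0)

lemma inner_quat: "a \<bullet> b = a$0 * b$0 + a$1 * b$1 + a$2 * b$2 + a$3 * b$3" for a b :: quat
  unfolding inner_vec_def UNIV_4_from_0 by simp

lemma qmul_nth:
  "(a \<odot> b)$0 = a$0*b$0 - a$1*b$1 - a$2*b$2 - a$3*b$3"
  "(a \<odot> b)$1 = a$0*b$1 + a$1*b$0 + a$2*b$3 - a$3*b$2"
  "(a \<odot> b)$2 = a$0*b$2 - a$1*b$3 + a$2*b$0 + a$3*b$1"
  "(a \<odot> b)$3 = a$0*b$3 + a$1*b$2 - a$2*b$1 + a$3*b$0"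
  by (simp_all add: qmul_def)

lemma qcnj_nth:
  "qcnj a $ 0 = a$0" "qcnj a $ 1 = - a$1" "qcnj a $ 2 = - a$2" "qcnj a $ 3 = - a$3"
  by (simp_all add: qcnj_def)

lemma qone_nth: "qone $ 0 = 1" "qone $ 1 = 0" "qone $ 2 = 0" "qone $ 3 = 0"
  by (simp_all add: qone_def axis_def)

lemmas quat_nth = qmul_nth qcnj_nth qone_nth

lemma qmul_assoc: "a \<odot> b \<odot> c = a \<odot> (b \<odot> c)"
  by (simp add: quat_eq_iff quat_nth algebra_simps)

lemma qone_mult [simp]: "qone \<odot> a = a" "a \<odot> qone = a"
  by (simp_all add: quat_eq_iff quat_nth)

lemma norm_quat: "(norm a)\<^sup>2 = (a$0)\<^sup>2 + (a$1)\<^sup>2 + (a$2)\<^sup>2 + (a$3)\<^sup>2" for a :: quat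
  unfolding power2_norm_eq_inner inner_quat by (simp add: power2_eq_square)

lemma norm_qmul: "norm (a \<odot> b) = norm a * norm b"
proof -
  have "(norm (a \<odot> b))\<^sup>2 = (norm a * norm b)\<^sup>2"
    unfolding power_mult_distrib norm_quat qmul_nth by (simp add: power2_eq_square algebra_simps)
  then show ?thesis by (simp add: power2_eq_iff_nonneg)
qed

lemma bounded_bilinear_qmul: "bounded_bilinear qmul"
proof
  fix a a' b b' :: quat and r :: real
  show "(a + a') \<odot> b = a \<odot> b + a' \<odot> b"
    by (simp add: quat_eq_iff quat_nth algebra_simps)
  show "a \<odot> (b + b') = a \<odot> b + a \<odot> b'"
    by (simp add: quat_eq_iff quat_nth algebra_simps)
  show "(r *\<^sub>R a) \<odot> b = r *\<^sub>R (a \<odot> b)"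
    by (simp add: quat_eq_iff quat_nth algebra_simps)
  show "a \<odot> (r *\<^sub>R b) = r *\<^sub>R (a \<odot> b)"
    by (simp add: quat_eq_iff quat_nth algebra_simps)
  show "\<exists>K. \<forall>a b. norm (a \<odot> b) \<le> norm a * norm b * K"
    by (rule exI[of _ 1]) (simp add: norm_qmul)
qed

lemmas qmul_bilinear =
  bounded_bilinear.add_left[OF bounded_bilinear_qmul]
  bounded_bilinear.add_right[OF bounded_bilinear_qmul]
  bounded_bilinear.diff_left[OF bounded_bilinear_qmul]
  bounded_bilinear.diff_right[OF bounded_bilinear_qmul]
  bounded_bilinear.minus_left[OF bounded_bilinear_qmul]
  bounded_bilinear.minus_right[OF bounded_bilinear_qmul]
  bounded_bilinear.scaleR_left[OF bounded_bilinear_qmul]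
  bounded_bilinear.scaleR_right[OF bounded_bilinear_qmul]
  bounded_bilinear.zero_left[OF bounded_bilinear_qmul]
  bounded_bilinear.zero_right[OF bounded_bilinear_qmul]

lemma norm_qcnj [simp]: "norm (qcnj a) = norm a"
proof -
  have "(norm (qcnj a))\<^sup>2 = (norm a)\<^sup>2" by (simp add: norm_quat quat_nth)
  then show ?thesis by (simp add: power2_eq_iff_nonneg)
qed

lemma qcnj_linear:
  "qcnj (a + b) = qcnj a + qcnj b" "qcnj (a - b) = qcnj a - qcnj b" "qcnj (- a) = - qcnj a"
  "qcnj (r *\<^sub>R a) = r *\<^sub>R qcnj a" "qcnj 0 = 0"
  by (simp_all add: quat_eq_iff quat_nth)

lemma qcnj_qcnj [simp]: "qcnj (qcnj a) = a"
  by (simp add: quat_eq_iff quat_nth)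

lemma qcnj_qone [simp]: "qcnj qone = qone"
  by (simp add: quat_eq_iff quat_nth)

lemma norm_qone [simp]: "norm qone = 1"
  by (simp add: qone_def norm_axis_1)

lemma qone_neq_0 [simp]: "qone \<noteq> 0" "0 \<noteq> qone"
  by (simp_all add: quat_eq_iff quat_nth)

lemma qcnj_qmul: "qcnj (a \<odot> b) = qcnj b \<odot> qcnj a"
  by (simp add: quat_eq_iff quat_nth algebra_simps)

lemma qmul_qcnj: "a \<odot> qcnj a = (norm a)\<^sup>2 *\<^sub>R qone" "qcnj a \<odot> a = (norm a)\<^sup>2 *\<^sub>R qone"
  by (simp_all add: quat_eq_iff quat_nth norm_quat, simp_all add: power2_eq_square algebra_simps)

lemma qmul_qcnj_cancel:
  "a \<odot> (qcnj a \<odot> b) = (norm a)\<^sup>2 *\<^sub>R b" "qcnj a \<odot> (a \<odot> b) = (norm a)\<^sup>2 *\<^sub>R b"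
  by (simp_all flip: qmul_assoc add: qmul_qcnj qmul_bilinear)

lemma inner_qmul_left: "(a \<odot> b) \<bullet> c = b \<bullet> (qcnj a \<odot> c)"
  by (simp add: inner_quat quat_nth algebra_simps)

lemma inner_qmul_right: "(a \<odot> b) \<bullet> c = a \<bullet> (c \<odot> qcnj b)"
  by (simp add: inner_quat quat_nth algebra_simps)

lemma inner_qmul_qmul: "(p \<odot> a) \<bullet> (p \<odot> b) = (norm p)\<^sup>2 * (a \<bullet> b)"
  "(a \<odot> p) \<bullet> (b \<odot> p) = (norm p)\<^sup>2 * (a \<bullet> b)"
  by (simp_all add: inner_qmul_left[of p a] inner_qmul_right[of a p] qmul_assoc qmul_qcnj
      qmul_qcnj_cancel qmul_bilinear)

lemma qRe_eq_inner: "qRe a = a \<bullet> qone"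
  by (simp add: inner_quat quat_nth qRe_def)

lemma add_qcnj: "a + qcnj a = (2 * qRe a) *\<^sub>R qone"
  by (simp add: quat_eq_iff quat_nth qRe_def)

lemma qmul_qcnj_swap: "a \<odot> qcnj b + b \<odot> qcnj a = (2 * (a \<bullet> b)) *\<^sub>R qone"
  by (simp add: quat_eq_iff quat_nth inner_quat algebra_simps)

text \<open>Multiply the polarized norm identity \<open>qmul_qcnj_swap\<close> by \<open>u\<close>
  on the right. For unit \<open>u\<close> this map is the negative of the reflection in the
  hyperplane orthogonal to \<open>u\<close>, which puts both reflections and boosts into
  quaternionic form.\<close>

lemma sandwich_qcnj: "u \<odot> (qcnj q \<odot> u) = (2 * (u \<bullet> q)) *\<^sub>R u - (norm u)\<^sup>2 *\<^sub>R q"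
proof -
  have "u \<odot> qcnj q \<odot> u + q \<odot> qcnj u \<odot> u = (2 * (u \<bullet> q)) *\<^sub>R u"
    by (simp flip: qmul_bilinear(1) add: qmul_qcnj_swap qmul_bilinear)
  then show ?thesis
    by (simp add: qmul_assoc qmul_qcnj qmul_bilinear algebra_simps)
qed

lemmas qmul_linear = qmul_bilinear qcnj_linear

lemmas qmul_simps = qmul_linear qmul_assoc qcnj_qmul

subsection \<open>Quaternionic matrices\<close>

lemma qmat_eq_iff:
  "A = B \<longleftrightarrow> A$0$0 = B$0$0 \<and> A$0$1 = B$0$1 \<and> A$1$0 = B$1$0 \<and> A$1$1 = B$1$1" for A B :: qmat
proof -
  have "A = B \<longleftrightarrow> A$0 = B$0 \<and> A$1 = B$1"
    unfolding vec_eq_iff[of A B] forall_2_from_0 ..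
  moreover have "A$i = B$i \<longleftrightarrow> A$i$0 = B$i$0 \<and> A$i$1 = B$i$1" for i
    unfolding vec_eq_iff[of "A$i" "B$i"] forall_2_from_0 ..
  ultimately show ?thesis by simp
qed

definition qmat_of :: "quat \<Rightarrow> quat \<Rightarrow> quat \<Rightarrow> quat \<Rightarrow> qmat" where
  "qmat_of a b c d = (\<chi> i j. if i = 0 then (if j = 0 then a else b) else (if j = 0 then c else d))"

lemma qmat_of_nth [simp]:
  "qmat_of a b c d $ 0 $ 0 = a" "qmat_of a b c d $ 0 $ 1 = b"
  "qmat_of a b c d $ 1 $ 0 = c" "qmat_of a b c d $ 1 $ 1 = d"
  by (simp_all add: qmat_of_def)

lemma qmatmul_nth [simp]: "qmatmul A B $ i $ j = A$i$0 \<odot> B$0$j + A$i$1 \<odot> B$1$j"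
  by (simp add: qmatmul_def)

lemma qmat_star_nth [simp]: "qmat_star A $ i $ j = qcnj (A$j$i)"
  by (simp add: qmat_star_def)

lemma qmat1_nth [simp]: "qmat1 $ i $ j = (if i = j then qone else 0)"
  by (simp add: qmat1_def)

lemma Jq_nth [simp]: "Jq $ i $ j = (if i = j then (if i = 0 then qone else - qone) else 0)"
  by (simp add: Jq_def)

lemma qmatmul_assoc: "qmatmul (qmatmul A B) C = qmatmul A (qmatmul B C)"
  by (simp add: qmat_eq_iff qmul_simps)

lemma qmatmul_qmat1 [simp]: "qmatmul qmat1 A = A" "qmatmul A qmat1 = A"
  by (simp_all add: qmat_eq_iff qmul_linear)

lemma qmat_star_qmatmul: "qmat_star (qmatmul A B) = qmatmul (qmat_star B) (qmat_star A)"
  by (simp add: qmat_eq_iff qmul_simps)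

text \<open>The two off-diagonal entries of A* J A = J are conjugate to each other, so three of the
  four entry equations remain.\<close>

lemma SU11H_iff:
  "A \<in> SU11H \<longleftrightarrow> (norm (A$0$0))\<^sup>2 - (norm (A$1$0))\<^sup>2 = 1 \<and> (norm (A$1$1))\<^sup>2 - (norm (A$0$1))\<^sup>2 = 1
     \<and> qcnj (A$0$0) \<odot> A$0$1 = qcnj (A$1$0) \<odot> A$1$1" (is "_ \<longleftrightarrow> ?R")
proof -
  have sc: "r *\<^sub>R qone = qone \<longleftrightarrow> r = 1" "r *\<^sub>R qone = - qone \<longleftrightarrow> r = -1" for r
    by (simp_all add: quat_eq_iff quat_nth)
  have "A \<in> SU11H \<longleftrightarrow>
     ((norm (A$0$0))\<^sup>2 - (norm (A$1$0))\<^sup>2) *\<^sub>R qone = qone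
   \<and> qcnj (A$0$0) \<odot> A$0$1 - qcnj (A$1$0) \<odot> A$1$1 = 0
   \<and> qcnj (A$0$1) \<odot> A$0$0 - qcnj (A$1$1) \<odot> A$1$0 = 0
   \<and> ((norm (A$0$1))\<^sup>2 - (norm (A$1$1))\<^sup>2) *\<^sub>R qone = - qone"
    by (simp add: SU11H_def qmat_eq_iff qmul_linear qmul_qcnj scaleR_diff_left)
  also have "qcnj (A$0$1) \<odot> A$0$0 - qcnj (A$1$1) \<odot> A$1$0 =
      qcnj (qcnj (A$0$0) \<odot> A$0$1 - qcnj (A$1$0) \<odot> A$1$1)"
    by (simp add: qmul_simps)
  also have "((norm (A$0$0))\<^sup>2 - (norm (A$1$0))\<^sup>2) *\<^sub>R qone = qone
   \<and> qcnj (A$0$0) \<odot> A$0$1 - qcnj (A$1$0) \<odot> A$1$1 = 0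
   \<and> qcnj (qcnj (A$0$0) \<odot> A$0$1 - qcnj (A$1$0) \<odot> A$1$1) = 0
   \<and> ((norm (A$0$1))\<^sup>2 - (norm (A$1$1))\<^sup>2) *\<^sub>R qone = - qone \<longleftrightarrow> ?R"
    unfolding sc using norm_qcnj[of "qcnj (A$0$0) \<odot> A$0$1 - qcnj (A$1$0) \<odot> A$1$1"] by (auto simp: qcnj_linear)
  finally show ?thesis .
qed

text \<open>The column relations from A* J A = J imply the row relations from A J A* = J. Taking
  norms in the mixed column relation gives |c| = |b| and then |d| = |a|; multiplying it by a on the
  left and by the conjugate of d on the right, and cancelling |a|^2 = |d|^2, gives the mixed row
  relation.\<close>

lemma SU11H_rels:
  assumes "A \<in> SU11H"
  shows "norm (A$1$0) = norm (A$0$1)" "norm (A$1$1) = norm (A$0$0)"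
    "(norm (A$0$0))\<^sup>2 = 1 + (norm (A$0$1))\<^sup>2"
    "qcnj (A$0$0) \<odot> A$0$1 = qcnj (A$1$0) \<odot> A$1$1"
    "A$0$0 \<odot> qcnj (A$1$0) = A$0$1 \<odot> qcnj (A$1$1)"
    "qcnj (A$0$1) \<odot> A$0$0 = qcnj (A$1$1) \<odot> A$1$0"
    "A$1$0 \<odot> qcnj (A$0$0) = A$1$1 \<odot> qcnj (A$0$1)"
proof -
  let ?a = "A$0$0" and ?b = "A$0$1" and ?c = "A$1$0" and ?d = "A$1$1"
  from assms have ac: "(norm ?a)\<^sup>2 - (norm ?c)\<^sup>2 = 1" and db: "(norm ?d)\<^sup>2 - (norm ?b)\<^sup>2 = 1"
    and m: "qcnj ?a \<odot> ?b = qcnj ?c \<odot> ?d" by (auto simp: SU11H_iff)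
  have "(norm ?a * norm ?b)\<^sup>2 = (norm ?c * norm ?d)\<^sup>2"
    using arg_cong[OF m, of norm] by (simp add: norm_qmul)
  then have "(1 + (norm ?c)\<^sup>2) * (norm ?b)\<^sup>2 = (norm ?c)\<^sup>2 * (1 + (norm ?b)\<^sup>2)"
    using ac db by (simp add: power_mult_distrib algebra_simps)
  then have cb2: "(norm ?c)\<^sup>2 = (norm ?b)\<^sup>2" by (simp add: algebra_simps)
  then show cb: "norm ?c = norm ?b" by (rule power2_eq_imp_eq) simp_all
  have ad2: "(norm ?d)\<^sup>2 = (norm ?a)\<^sup>2" using ac db cb2 by linarith
  then show ad: "norm ?d = norm ?a" by (rule power2_eq_imp_eq) (rule norm_ge_zero)+
  show "(norm ?a)\<^sup>2 = 1 + (norm ?b)\<^sup>2" using ac cb2 by linarith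
  show "qcnj ?a \<odot> ?b = qcnj ?c \<odot> ?d" by fact
  have n: "(norm ?a)\<^sup>2 \<noteq> 0" using ac zero_le_power2[of "norm ?c"] by linarith
  have "?a \<odot> (qcnj ?a \<odot> ?b) \<odot> qcnj ?d = ?a \<odot> (qcnj ?c \<odot> ?d) \<odot> qcnj ?d" by (simp add: m)
  then have "(norm ?a)\<^sup>2 *\<^sub>R (?b \<odot> qcnj ?d) = (norm ?a)\<^sup>2 *\<^sub>R (?a \<odot> qcnj ?c)"
    by (simp add: qmul_assoc qmul_qcnj qmul_qcnj_cancel qmul_linear ad2)
  then show ac': "?a \<odot> qcnj ?c = ?b \<odot> qcnj ?d" using n by simp
  show "qcnj ?b \<odot> ?a = qcnj ?d \<odot> ?c" using arg_cong[OF m, of qcnj] by (simp add: qmul_simps)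
  show "?c \<odot> qcnj ?a = ?d \<odot> qcnj ?b" using arg_cong[OF ac', of qcnj] by (simp add: qmul_simps)
qed

lemma SU11H_00_nz: "A \<in> SU11H \<Longrightarrow> A$0$0 \<noteq> 0"
  using SU11H_rels(3)[of A] by (smt (verit) norm_zero power_zero_numeral zero_le_power2)

lemma SU11H_qmat1: "qmat1 \<in> SU11H"
  by (simp add: SU11H_iff qmul_linear)

lemma SU11H_qmatmul:
  assumes "A \<in> SU11H" "B \<in> SU11H"
  shows "qmatmul A B \<in> SU11H"
proof -
  have "qmatmul (qmatmul (qmat_star (qmatmul A B)) Jq) (qmatmul A B)
      = qmatmul (qmat_star B) (qmatmul (qmatmul (qmatmul (qmat_star A) Jq) A) B)"
    by (simp only: qmat_star_qmatmul qmatmul_assoc)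
  also have "\<dots> = Jq"
    using assms by (simp only: SU11H_def mem_Collect_eq flip: qmatmul_assoc)
  finally show ?thesis by (simp only: SU11H_def mem_Collect_eq)
qed

text \<open>This is J A* J, the inverse dictated by A* J A = J.\<close>

definition qmat_inv :: "qmat \<Rightarrow> qmat" where
  "qmat_inv A = qmat_of (qcnj (A$0$0)) (- qcnj (A$1$0)) (- qcnj (A$0$1)) (qcnj (A$1$1))"

lemma qmat_inv_SU11H [simp]:
  assumes "A \<in> SU11H"
  shows "qmat_inv A \<in> SU11H"
proof -
  note r = SU11H_rels[OF assms]
  show ?thesis
    unfolding SU11H_iff qmat_inv_def qmat_of_nth qcnj_qcnj norm_minus_cancel norm_qcnj
      r(1,2,3) qmul_linear r(5)
    by simp
qed

lemma qmatmul_qmat_inv [simp]: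
  assumes "A \<in> SU11H"
  shows "qmatmul (qmat_inv A) A = qmat1" "qmatmul A (qmat_inv A) = qmat1"
  using SU11H_rels[OF assms]
  by (simp_all add: qmat_eq_iff qmat_inv_def qmul_linear qmul_qcnj scaleR_add_left)

lemma qmatmul_qmat_inv_cancel [simp]:
  assumes "A \<in> SU11H"
  shows "qmatmul (qmat_inv A) (qmatmul A B) = B" "qmatmul A (qmatmul (qmat_inv A) B) = B"
  by (simp_all flip: qmatmul_assoc add: assms)

lemma qmat_inv_unique: "A \<in> SU11H \<Longrightarrow> qmatmul A B = qmat1 \<Longrightarrow> B = qmat_inv A"
  by (metis qmatmul_qmat1(2) qmatmul_qmat_inv_cancel(1))

section \<open>Coordinates on Minkowski space and the ball chart of the hyperboloid\<close>

definition qpart :: "real^5 \<Rightarrow> quat" where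
  "qpart x = (\<chi> i. if i = 0 then x$0 else if i = 1 then x$1 else if i = 2 then x$2 else x$3)"

definition hvec :: "quat \<Rightarrow> real \<Rightarrow> real^5" where
  "hvec q t = (\<chi> i. if i = 4 then t else if i = 0 then q$0 else if i = 1 then q$1 else if i = 2 then q$2 else q$3)"

lemma qpart_nth: "qpart x $ 0 = x$0" "qpart x $ 1 = x$1" "qpart x $ 2 = x$2" "qpart x $ 3 = x$3"
  by (simp_all add: qpart_def)

lemma hvec_nth:
  "hvec q t $ 0 = q$0" "hvec q t $ 1 = q$1" "hvec q t $ 2 = q$2" "hvec q t $ 3 = q$3" "hvec q t $ 4 = t"
  by (simp_all add: hvec_def)

lemma qpart_hvec [simp]: "qpart (hvec q t) = q"
  by (simp add: quat_eq_iff qpart_nth hvec_nth)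

lemma hvec_4 [simp]: "hvec q t $ 4 = t"
  by (simp add: hvec_nth)

lemma vec5_eq_iff: "x = y \<longleftrightarrow> qpart x = qpart y \<and> x$4 = y$4"
  by (simp add: vec_eq_iff[of x y] forall_5_from_0 quat_eq_iff qpart_nth)

lemma hvec_qpart [simp]: "hvec (qpart x) (x$4) = x"
  by (simp add: vec5_eq_iff)

lemma qpart_linear: "qpart (x + y) = qpart x + qpart y" "qpart (x - y) = qpart x - qpart y"
    "qpart (r *\<^sub>R x) = r *\<^sub>R qpart x"
  by (simp_all add: quat_eq_iff qpart_nth)

lemma lorentz_qpart: "lorentz x y = qpart x \<bullet> qpart y - x$4 * y$4"
  by (simp add: lorentz_def inner_quat qpart_nth)

lemma H4_qpart: "x \<in> H4 \<longleftrightarrow> (norm (qpart x))\<^sup>2 - (x$4)\<^sup>2 = -1 \<and> x$4 > 0"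
  by (simp add: H4_def norm_quat qpart_nth)

lemma H4_lorentz: "x \<in> H4 \<longleftrightarrow> lorentz x x = -1 \<and> x$4 > 0"
  unfolding H4_qpart lorentz_qpart by (simp only: power2_norm_eq_inner power2_eq_square[of "x$4"])

lemma e5_hvec: "e5 = hvec 0 1"
  by (simp add: e5_def vec_eq_iff forall_5_from_0 hvec_nth axis_def)

lemma zeta_hvec: "zeta y = hvec ((2 / (1 - (norm y)\<^sup>2)) *\<^sub>R y) ((1 + (norm y)\<^sup>2) / (1 - (norm y)\<^sup>2))"
  by (simp add: vec_eq_iff forall_5_from_0 hvec_nth zeta_def)

lemma zeta_inv_qpart: "zeta_inv x = (1 / (1 + x$4)) *\<^sub>R qpart x"
  by (simp add: quat_eq_iff zeta_inv_def qpart_nth)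

lemma norm2_lt_1: "norm y < 1 \<Longrightarrow> (norm y)\<^sup>2 < 1" for y :: "'a::real_normed_vector"
  by (simp add: power_less_one_iff abs_square_less_1)

lemma zeta_in_H4: "norm y < 1 \<Longrightarrow> zeta y \<in> H4"
proof -
  assume "norm y < 1"
  then have "1 - (norm y)\<^sup>2 > 0" using norm2_lt_1 by auto
  moreover from this have "1 + (norm y)\<^sup>2 > 0" by (simp add: add_pos_nonneg)
  ultimately show ?thesis
    unfolding H4_qpart zeta_hvec qpart_hvec hvec_4
    by (simp add: power_mult_distrib power_divide field_simps) (simp add: power2_eq_square algebra_simps)
qed

lemma zeta_inv_zeta: "norm y < 1 \<Longrightarrow> zeta_inv (zeta y) = y"
proof -
  assume "norm y < 1"
  then have p: "1 - (norm y)\<^sup>2 > 0" using norm2_lt_1 by auto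
  then have "1 / (1 + (1 + (norm y)\<^sup>2) / (1 - (norm y)\<^sup>2)) * (2 / (1 - (norm y)\<^sup>2)) = 1"
    by (simp add: field_simps)
  then show ?thesis
    unfolding zeta_inv_qpart zeta_hvec qpart_hvec hvec_4 scaleR_scaleR by simp
qed

lemma zeta_inv_H4:
  assumes "x \<in> H4"
  shows "norm (zeta_inv x) < 1" "zeta (zeta_inv x) = x"
proof -
  have t: "x$4 > 0" and n: "(norm (qpart x))\<^sup>2 = (x$4)\<^sup>2 - 1" using assms by (auto simp: H4_qpart)
  have n2: "(norm (zeta_inv x))\<^sup>2 = (x$4 - 1) / (x$4 + 1)"
  proof -
    have "1 + x$4 \<noteq> 0" using t by simp
    then show ?thesis
      unfolding zeta_inv_qpart using t
      by (simp add: power_mult_distrib n power_divide frac_eq_eq) (simp add: power2_eq_square algebra_simps)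
  qed
  also have "\<dots> < 1" using t by (simp add: field_simps)
  finally show "norm (zeta_inv x) < 1" by (simp add: power_less_one_iff abs_square_less_1)
  have e: "1 - (norm (zeta_inv x))\<^sup>2 = 2 / (x$4 + 1)" "1 + (norm (zeta_inv x))\<^sup>2 = 2 * x$4 / (x$4 + 1)"
    using t by (simp_all add: n2 field_simps)
  show "zeta (zeta_inv x) = x"
    unfolding zeta_hvec e vec5_eq_iff qpart_hvec hvec_4 unfolding zeta_inv_qpart
    using t by (simp add: field_simps)
qed

subsection \<open>The action on Minkowski space\<close>

text \<open>The first row of A X A* written out, where X is the Hermitian matrix
  \<open>herm x\<close>. Defining it by coordinates makes it linear for every matrix
  \<open>A\<close>; that the second row carries the same data is where \<open>SU11H\<close>
  enters.\<close>

definition spin_act :: "qmat \<Rightarrow> real^5 \<Rightarrow> real^5" where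
  "spin_act A x = hvec
     (A$0$0 \<odot> qpart x \<odot> qcnj (A$1$1) + A$0$1 \<odot> qcnj (qpart x) \<odot> qcnj (A$1$0)
        + x$4 *\<^sub>R (A$0$0 \<odot> qcnj (A$1$0) + A$0$1 \<odot> qcnj (A$1$1)))
     (((norm (A$0$0))\<^sup>2 + (norm (A$0$1))\<^sup>2) * x$4 + 2 * ((A$0$0 \<odot> qpart x) \<bullet> A$0$1))"

lemma linear_spin_act: "linear (spin_act A)"
  by (rule linearI)
    (simp_all add: vec5_eq_iff spin_act_def qpart_linear qmul_linear inner_add_left scaleR_add_right
      algebra_simps)

definition herm :: "real^5 \<Rightarrow> qmat" where
  "herm x = qmat_of (x$4 *\<^sub>R qone) (qpart x) (qcnj (qpart x)) (x$4 *\<^sub>R qone)"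

lemma herm_inject: "herm x = herm y \<longleftrightarrow> x = y"
  by (auto simp: herm_def qmat_eq_iff vec5_eq_iff)

text \<open>Together with the norm relations this makes the two diagonal entries of A X A* agree, so
  that the result is again of the form \<open>herm\<close>.\<close>

lemma SU11H_inner_rows: "A \<in> SU11H \<Longrightarrow> (A$1$0 \<odot> q) \<bullet> A$1$1 = (A$0$0 \<odot> q) \<bullet> A$0$1"
  using SU11H_rels(4)[of A] by (simp add: inner_qmul_left)

lemma herm_spin_act:
  assumes "A \<in> SU11H"
  shows "herm (spin_act A x) = qmatmul (qmatmul A (herm x)) (qmat_star A)"
proof -
  let ?a = "A$0$0" and ?b = "A$0$1" and ?c = "A$1$0" and ?d = "A$1$1" and ?q = "qpart x"
  have ab: "?a \<odot> ?q \<odot> qcnj ?b + ?b \<odot> qcnj (?a \<odot> ?q) = (2 * ((?a \<odot> ?q) \<bullet> ?b)) *\<^sub>R qone"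
    by (rule qmul_qcnj_swap)
  have cd: "?c \<odot> ?q \<odot> qcnj ?d + ?d \<odot> qcnj (?c \<odot> ?q) = (2 * ((?a \<odot> ?q) \<bullet> ?b)) *\<^sub>R qone"
    unfolding SU11H_inner_rows[OF assms, symmetric] by (rule qmul_qcnj_swap)
  show ?thesis
    unfolding qmat_eq_iff
  proof (intro conjI)
    show "herm (spin_act A x) $ 0 $ 0 = qmatmul (qmatmul A (herm x)) (qmat_star A) $ 0 $ 0"
      using ab by (simp add: herm_def spin_act_def qmul_linear qmul_qcnj qmul_assoc qcnj_qmul algebra_simps)
    show "herm (spin_act A x) $ 1 $ 1 = qmatmul (qmatmul A (herm x)) (qmat_star A) $ 1 $ 1"
      using cd SU11H_rels(1,2)[OF assms]
      by (simp add: herm_def spin_act_def qmul_linear qmul_qcnj qmul_assoc qcnj_qmul algebra_simps)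
  qed (simp_all add: herm_def spin_act_def qmul_linear qmul_assoc qcnj_qmul algebra_simps)
qed

lemma spin_act_qmatmul:
  assumes "A \<in> SU11H" "B \<in> SU11H"
  shows "spin_act (qmatmul A B) x = spin_act A (spin_act B x)"
proof -
  have "herm (spin_act (qmatmul A B) x) = herm (spin_act A (spin_act B x))"
    by (simp only: herm_spin_act assms SU11H_qmatmul qmat_star_qmatmul qmatmul_assoc)
  then show ?thesis by (simp only: herm_inject)
qed

lemma spin_act_qmat1 [simp]: "spin_act qmat1 x = x"
  by (simp add: spin_act_def qmul_linear)

lemma spin_act_qmat_inv [simp]:
  assumes "A \<in> SU11H"
  shows "spin_act A (spin_act (qmat_inv A) x) = x" "spin_act (qmat_inv A) (spin_act A x) = x"
  using assms by (simp_all flip: spin_act_qmatmul)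

text \<open>The first identity is invariance of the form J, evaluated on the column (y, 1). The
  second gives the last coordinate of \<open>zeta (mob A y)\<close> after division by 1 -
  |y|^2.\<close>

lemma SU11H_norm_mob_parts:
  assumes "A \<in> SU11H"
  shows "(norm (A$1$0 \<odot> y + A$1$1))\<^sup>2 - (norm (A$0$0 \<odot> y + A$0$1))\<^sup>2 = 1 - (norm y)\<^sup>2"
    "(norm (A$1$0 \<odot> y + A$1$1))\<^sup>2 + (norm (A$0$0 \<odot> y + A$0$1))\<^sup>2 =
      ((norm (A$0$0))\<^sup>2 + (norm (A$0$1))\<^sup>2) * (1 + (norm y)\<^sup>2) + 4 * ((A$0$0 \<odot> y) \<bullet> A$0$1)"
proof -
  have ex: "(norm (p \<odot> y + q))\<^sup>2 = (norm p)\<^sup>2 * (norm y)\<^sup>2 + (norm q)\<^sup>2 + 2 * ((p \<odot> y) \<bullet> q)" for p q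
  proof -
    have "(norm (v + q))\<^sup>2 = (norm v)\<^sup>2 + (norm q)\<^sup>2 + 2 * (v \<bullet> q)" for v
      by (simp add: power2_norm_eq_inner inner_add_left inner_add_right inner_commute)
    then show ?thesis by (simp add: norm_qmul power_mult_distrib)
  qed
  note r = SU11H_rels[OF assms]
  show "(norm (A$1$0 \<odot> y + A$1$1))\<^sup>2 - (norm (A$0$0 \<odot> y + A$0$1))\<^sup>2 = 1 - (norm y)\<^sup>2"
    "(norm (A$1$0 \<odot> y + A$1$1))\<^sup>2 + (norm (A$0$0 \<odot> y + A$0$1))\<^sup>2 =
      ((norm (A$0$0))\<^sup>2 + (norm (A$0$1))\<^sup>2) * (1 + (norm y)\<^sup>2) + 4 * ((A$0$0 \<odot> y) \<bullet> A$0$1)"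
    unfolding ex SU11H_inner_rows[OF assms] r(1,2,3) by (simp_all add: algebra_simps)
qed

lemma norm_qinv: "norm (qinv r) = 1 / norm r"
  by (simp add: qinv_def power2_eq_square)

text \<open>With s = a y + b and r = c y + d, the image is s times the conjugate of r over |r|^2.
  Its defect 1 - |mob A y|^2 equals (1 - |y|^2) / |r|^2, so |r|^2 cancels from \<open>zeta\<close>
  and only expressions bilinear in r and s remain, to be compared with
  \<open>spin_act\<close>.\<close>

lemma
  assumes A: "A \<in> SU11H" and y: "norm y < 1"
  shows norm_mob: "norm (mob A y) < 1"
    and zeta_mob: "zeta (mob A y) = spin_act A (zeta y)"
proof -
  let ?a = "A$0$0" and ?b = "A$0$1" and ?c = "A$1$0" and ?d = "A$1$1"
  define r where "r = ?c \<odot> y + ?d"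
  define s where "s = ?a \<odot> y + ?b"
  note rel = SU11H_rels[OF A]
  have y2: "1 - (norm y)\<^sup>2 > 0" using norm2_lt_1[OF y] by simp
  have rs: "(norm r)\<^sup>2 - (norm s)\<^sup>2 = 1 - (norm y)\<^sup>2"
    "(norm r)\<^sup>2 + (norm s)\<^sup>2 = ((norm ?a)\<^sup>2 + (norm ?b)\<^sup>2) * (1 + (norm y)\<^sup>2) + 4 * ((?a \<odot> y) \<bullet> ?b)"
    unfolding r_def s_def by (fact SU11H_norm_mob_parts[OF A])+
  have r2: "(norm r)\<^sup>2 > 0" using rs(1) y2 zero_le_power2[of "norm s"] by linarith
  have n: "(norm (mob A y))\<^sup>2 = (norm s)\<^sup>2 / (norm r)\<^sup>2"
    by (simp add: mob_def norm_qmul norm_qinv power_mult_distrib power_divide flip: r_def s_def)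
  also have "\<dots> < 1" using rs(1) y2 r2 by (simp add: field_simps)
  finally show "norm (mob A y) < 1" by (simp add: power_less_one_iff abs_square_less_1)
  have n1: "1 - (norm (mob A y))\<^sup>2 = (1 - (norm y)\<^sup>2) / (norm r)\<^sup>2"
    "1 + (norm (mob A y))\<^sup>2 = ((norm r)\<^sup>2 + (norm s)\<^sup>2) / (norm r)\<^sup>2"
    unfolding n rs(1)[symmetric] using r2 by (simp_all add: field_simps)
  have "(2 / (1 - (norm (mob A y))\<^sup>2)) *\<^sub>R mob A y = (2 / (1 - (norm y)\<^sup>2)) *\<^sub>R (s \<odot> qcnj r)"
    unfolding n1 unfolding mob_def qinv_def r_def[symmetric] s_def[symmetric] using r2
    by (simp add: qmul_linear)
  also have "\<dots> = (1 / (1 - (norm y)\<^sup>2)) *\<^sub>R (2 *\<^sub>R (s \<odot> qcnj r))"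
    by simp
  also have "2 *\<^sub>R (s \<odot> qcnj r) = 2 *\<^sub>R (?a \<odot> y \<odot> qcnj ?d) + 2 *\<^sub>R (?b \<odot> qcnj y \<odot> qcnj ?c)
      + (1 + (norm y)\<^sup>2) *\<^sub>R (?a \<odot> qcnj ?c + ?b \<odot> qcnj ?d)"
  proof -
    have "s \<odot> qcnj r = (norm y)\<^sup>2 *\<^sub>R (?a \<odot> qcnj ?c) + ?a \<odot> y \<odot> qcnj ?d
        + ?b \<odot> qcnj y \<odot> qcnj ?c + ?b \<odot> qcnj ?d"
      unfolding s_def r_def by (simp add: qmul_linear qcnj_qmul qmul_assoc qmul_qcnj_cancel)
    \<comment> \<open>The row relation equates a c* with b d*, so |y|^2 and 1 may be redistributed
      into the common coefficient 1 + |y|^2.\<close>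
    then show ?thesis unfolding rel(5) by (simp add: algebra_simps flip: scaleR_2)
  qed
  finally have q: "(2 / (1 - (norm (mob A y))\<^sup>2)) *\<^sub>R mob A y = qpart (spin_act A (zeta y))"
    unfolding spin_act_def zeta_hvec qpart_hvec hvec_4 by (simp add: qmul_linear scaleR_add_right)
  have t: "(1 + (norm (mob A y))\<^sup>2) / (1 - (norm (mob A y))\<^sup>2) = spin_act A (zeta y) $ 4"
    unfolding n1 spin_act_def zeta_hvec qpart_hvec hvec_4 rs(2) using r2
    by (simp add: qmul_linear) (simp add: add_divide_distrib algebra_simps)
  show "zeta (mob A y) = spin_act A (zeta y)"
    unfolding vec5_eq_iff using q t by (simp add: zeta_hvec)
qed

subsection \<open>Generation by boosts and Spin(4)\<close>

text \<open>For c^2 = 1 + |u|^2 and c > 0 these are the hyperbolic translations along geodesics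
  through \<open>e5\<close>, with c and |u| the cosh and sinh of half the translation
  length.\<close>

definition boost :: "real \<Rightarrow> quat \<Rightarrow> qmat" where
  "boost c u = qmat_of (c *\<^sub>R qone) u (qcnj u) (c *\<^sub>R qone)"

lemma boost_SU11H: "c\<^sup>2 = 1 + (norm u)\<^sup>2 \<Longrightarrow> boost c u \<in> SU11H"
  by (simp add: SU11H_iff boost_def qmul_linear qcnj_linear)

lemma Spin4_SU11H: "A \<in> Spin4 \<Longrightarrow> A \<in> SU11H"
  by (simp add: SU11H_iff Spin4_def qmul_linear)

lemma spin_act_Spin4:
  "A \<in> Spin4 \<Longrightarrow> spin_act A x = hvec (A$0$0 \<odot> qpart x \<odot> qcnj (A$1$1)) (x$4)"
  by (simp add: spin_act_def Spin4_def qmul_linear)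

lemma spin_act_boost:
  assumes "c\<^sup>2 = 1 + (norm u)\<^sup>2"
  shows "spin_act (boost c u) x = hvec (qpart x + (2 * (u \<bullet> qpart x + c * x$4)) *\<^sub>R u)
           (2 * c * (u \<bullet> qpart x + c * x$4) - x$4)"
proof -
  have cc: "c * c = 1 + (norm u)\<^sup>2" using assms by (simp add: power2_eq_square)
  have "qpart (spin_act (boost c u) x) = (c * c) *\<^sub>R qpart x
      + ((2 * (u \<bullet> qpart x)) *\<^sub>R u - (norm u)\<^sup>2 *\<^sub>R qpart x) + x$4 *\<^sub>R (c *\<^sub>R u + c *\<^sub>R u)"
    by (simp add: spin_act_def boost_def qmul_linear qmul_assoc sandwich_qcnj)
  also have "\<dots> = qpart x + (2 * (u \<bullet> qpart x + c * x$4)) *\<^sub>R u"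
    unfolding cc by (simp add: quat_eq_iff algebra_simps)
  finally have q: "qpart (spin_act (boost c u) x) = qpart x + (2 * (u \<bullet> qpart x + c * x$4)) *\<^sub>R u" .
  have "spin_act (boost c u) x $ 4 = (c * c + (norm u)\<^sup>2) * x$4 + 2 * (c * (u \<bullet> qpart x))"
    by (simp add: spin_act_def boost_def qmul_linear inner_commute[of u] power2_eq_square[of c])
  also have "(norm u)\<^sup>2 = c * c - 1" using cc by simp
  also have "(c * c + (c * c - 1)) * x$4 + 2 * (c * (u \<bullet> qpart x))
      = 2 * c * (u \<bullet> qpart x + c * x$4) - x$4"
    by (simp add: algebra_simps)
  finally show ?thesis using q by (simp only: vec5_eq_iff qpart_hvec hvec_4)
qed

lemma lorentz_boost:
  assumes "c\<^sup>2 = 1 + (norm u)\<^sup>2"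
  shows "lorentz (spin_act (boost c u) x) (spin_act (boost c u) y) = lorentz x y"
proof -
  have cc: "u \<bullet> u = c * c - 1" using assms by (simp add: dot_square_norm power2_eq_square)
  show ?thesis
    unfolding spin_act_boost[OF assms] lorentz_qpart qpart_hvec hvec_4
    by (simp add: inner_add_left inner_add_right cc inner_commute[of "qpart x" u])
      (simp add: algebra_simps)
qed

text \<open>Polar decomposition. Both diagonal entries of A have norm c = |a|, so D is the diagonal
  of A normalized, and u is then forced to be b times the inverse of \<open>D$1$1\<close>.\<close>

lemma SU11H_decomposition:
  assumes "A \<in> SU11H"
  obtains c u D where "c\<^sup>2 = 1 + (norm u)\<^sup>2" "c > 0" "D \<in> Spin4" "A = qmatmul (boost c u) D"
proof -
  let ?a = "A$0$0" and ?b = "A$0$1" and ?c = "A$1$0" and ?d = "A$1$1"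
  define c where "c = norm ?a"
  note r = SU11H_rels[OF assms]
  have c: "c > 0" using SU11H_00_nz[OF assms] by (simp add: c_def)
  have nd: "norm ?d = c" using r(2) by (simp add: c_def)
  define D where "D = qmat_of ((1/c) *\<^sub>R ?a) 0 0 ((1/c) *\<^sub>R ?d)"
  define u where "u = (1/c) *\<^sub>R (?b \<odot> qcnj ?d)"
  have nu: "norm u = norm ?b" using c by (simp add: u_def norm_qmul nd)
  have 1: "c\<^sup>2 = 1 + (norm u)\<^sup>2" using r(3) by (simp add: nu c_def)
  have 2: "D \<in> Spin4" using c nd by (simp add: Spin4_def D_def c_def)
  have "?b \<odot> qcnj ?d \<odot> ?d = c\<^sup>2 *\<^sub>R ?b" "?d \<odot> qcnj ?b \<odot> ?a = c\<^sup>2 *\<^sub>R ?c"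
    by (simp_all add: qmul_assoc qmul_qcnj qmul_linear nd r(6) qmul_qcnj_cancel)
  then have "A = qmatmul (boost c u) D" using c
    by (simp add: qmat_eq_iff D_def boost_def u_def qmul_linear qcnj_qmul power2_eq_square)
  with 1 2 c show thesis using that by blast
qed

lemma lorentz_spin_act:
  assumes "A \<in> SU11H"
  shows "lorentz (spin_act A x) (spin_act A y) = lorentz x y"
proof -
  obtain c u D where 1: "c\<^sup>2 = 1 + (norm u)\<^sup>2" and D: "D \<in> Spin4" and A: "A = qmatmul (boost c u) D"
    using SU11H_decomposition[OF assms] by metis
  have "lorentz (spin_act D x) (spin_act D y) = lorentz x y"
    using D unfolding spin_act_Spin4[OF D] lorentz_qpart
    by (simp add: inner_qmul_qmul Spin4_def)
  then show ?thesis
    by (simp add: A spin_act_qmatmul boost_SU11H 1 Spin4_SU11H D lorentz_boost)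
qed

section \<open>Square roots in the spin group and the determinant\<close>

lemma qmul_self: "p \<odot> p = (2 * qRe p) *\<^sub>R p - (norm p)\<^sup>2 *\<^sub>R qone"
  by (simp add: quat_eq_iff quat_nth norm_quat qRe_def, simp add: power2_eq_square algebra_simps)

text \<open>Normalizing 1 + p halves the angle: for unit p the quadratic equation of 1 + p gives (1
  + p)^2 = |1 + p|^2 p. This degenerates only at p = -1, where the imaginary unit i is a
  root.\<close>

lemma unit_quat_sqrt:
  assumes "norm p = 1"
  obtains r where "norm r = 1" "r \<odot> r = p"
proof (cases "p = - qone")
  case True
  have "norm (axis 1 1 :: quat) = 1" by (simp add: norm_axis_1)
  moreover have "axis 1 1 \<odot> axis 1 1 = - qone" by (simp add: quat_eq_iff quat_nth axis_def)
  ultimately show ?thesis using True that by blast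
next
  case False
  let ?s = "qone + p"
  have s: "norm ?s \<noteq> 0" using False by (simp add: add_eq_0_iff minus_equation_iff)
  have n: "(norm ?s)\<^sup>2 = 2 + 2 * qRe p"
    by (simp add: power2_norm_eq_inner inner_add_left inner_add_right inner_commute qRe_eq_inner)
      (simp add: assms dot_square_norm)
  have "qRe ?s = 1 + qRe p" by (simp add: qRe_def quat_nth)
  then have "?s \<odot> ?s = (norm ?s)\<^sup>2 *\<^sub>R p"
    unfolding qmul_self n by (simp add: quat_eq_iff algebra_simps)
  then have "((1 / norm ?s) *\<^sub>R ?s) \<odot> ((1 / norm ?s) *\<^sub>R ?s) = p"
    using s by (simp only: qmul_bilinear(7,8)) (simp add: power2_eq_square)
  moreover have "norm ((1 / norm ?s) *\<^sub>R ?s) = 1" using s by simp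
  ultimately show ?thesis using that by blast
qed

lemma Spin4_sqrt:
  assumes "D \<in> Spin4"
  obtains E where "E \<in> Spin4" "D = qmatmul E E"
proof -
  have D: "D$0$1 = 0" "D$1$0 = 0" "norm (D$0$0) = 1" "norm (D$1$1) = 1"
    using assms by (auto simp: Spin4_def)
  obtain p where p: "norm p = 1" "p \<odot> p = D$0$0" using unit_quat_sqrt[OF D(3)] .
  obtain q where q: "norm q = 1" "q \<odot> q = D$1$1" using unit_quat_sqrt[OF D(4)] .
  have "qmat_of p 0 0 q \<in> Spin4" using p q by (simp add: Spin4_def)
  moreover have "D = qmatmul (qmat_of p 0 0 q) (qmat_of p 0 0 q)"
    by (simp add: qmat_eq_iff qmul_linear p q D)
  ultimately show thesis by (rule that)
qed

lemma boost_sqrt: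
  assumes "c\<^sup>2 = 1 + (norm u)\<^sup>2" "c > 0"
  obtains B where "B \<in> SU11H" "boost c u = qmatmul B B"
proof -
  \<comment> \<open>Half-argument formulas: if c = cosh t and |u| = sinh t, then k (c + 1) =
    cosh(t/2) and k |u| = sinh(t/2).\<close>
  define k where "k = 1 / sqrt (2 * c + 2)"
  have k2: "k\<^sup>2 * (2 * c + 2) = 1" using assms(2) by (simp add: k_def power_divide)
  define B where "B = boost (k * (c + 1)) (k *\<^sub>R u)"
  have n: "(norm u)\<^sup>2 = c * c - 1" using assms(1) by (simp add: power2_eq_square)
  have "(k * (c + 1))\<^sup>2 - (norm (k *\<^sub>R u))\<^sup>2 = k\<^sup>2 * (2 * c + 2)"
    by (simp add: power_mult_distrib n) (simp add: power2_eq_square algebra_simps)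
  then have "B \<in> SU11H" unfolding B_def k2 by (intro boost_SU11H) simp
  moreover have "boost c u = qmatmul B B"
  proof -
    have a: "k * (c + 1) * (k * (c + 1)) + k * k * (norm u)\<^sup>2 = c * (k\<^sup>2 * (2 * c + 2))"
      unfolding n by (simp add: power2_eq_square algebra_simps)
    have b: "k * (c + 1) * k + k * (k * (c + 1)) = k\<^sup>2 * (2 * c + 2)"
      by (simp add: power2_eq_square algebra_simps)
    show ?thesis
      using a b unfolding k2
      by (simp add: qmat_eq_iff B_def boost_def qmul_linear qmul_qcnj flip: scaleR_add_left)
  qed
  ultimately show thesis using that by blast
qed

lemma matrix_spin_act_qmatmul:
  assumes "A \<in> SU11H" "B \<in> SU11H"
  shows "matrix (spin_act (qmatmul A B)) = matrix (spin_act A) ** matrix (spin_act B)"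
proof -
  have "spin_act (qmatmul A B) = spin_act A \<circ> spin_act B"
    by (rule ext) (simp add: spin_act_qmatmul assms)
  then show ?thesis by (simp only: matrix_compose linear_spin_act)
qed

lemma matrix_spin_act_mult [simp]: "matrix (spin_act A) *v x = spin_act A x"
  by (simp add: matrix_works linear_spin_act)

text \<open>With J the Gram matrix of the form, invariance reads G^T J G = J, and J is invertible
  because it is an involution.\<close>

lemma det_lorentz:
  assumes "\<And>x y. lorentz (G *v x) (G *v y) = lorentz x y"
  shows "(det G)\<^sup>2 = 1"
proof -
  define h :: "real^5 \<Rightarrow> real^5" where "h x = hvec (qpart x) (- x$4)" for x
  define J where "J = matrix h"
  have lin: "linear h"
    by (rule linearI) (simp_all add: h_def vec5_eq_iff qpart_linear)
  then have Jh: "J *v x = h x" for x by (simp add: J_def matrix_works)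
  have dot: "x \<bullet> (J *v y) = lorentz x y" for x y
    unfolding Jh inner_vec_def UNIV_5_from_0 by (simp add: h_def hvec_nth qpart_nth lorentz_def)
  have "J ** J = mat 1"
    by (simp add: matrix_eq Jh flip: matrix_vector_mul_assoc) (simp add: h_def)
  then have J0: "det J \<noteq> 0" by (metis det_I det_mul mult_zero_left zero_neq_one)
  have "x \<bullet> ((transpose G ** J ** G) *v y) = x \<bullet> (J *v y)" for x y
  proof -
    have "x \<bullet> ((transpose G ** J ** G) *v y) = (G *v x) \<bullet> (J *v (G *v y))"
      by (simp add: dot_lmul_matrix flip: matrix_vector_mul_assoc)
        (simp add: dot_lmul_matrix inner_commute flip: vector_transpose_matrix)
    then show ?thesis by (simp only: dot assms)
  qed
  then have "transpose G ** J ** G = J"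
    unfolding matrix_eq by (metis vector_eq_ldot)
  then have "det G * det J * det G = det J"
    by (metis det_mul det_transpose)
  then show ?thesis using J0 by (simp add: power2_eq_square)
qed

lemma det_spin_act_square:
  assumes "B \<in> SU11H"
  shows "det (matrix (spin_act (qmatmul B B))) = 1"
  using det_lorentz[of "matrix (spin_act B)"] lorentz_spin_act[OF assms]
  by (simp add: matrix_spin_act_qmatmul assms det_mul power2_eq_square)

text \<open>Every element is a product of two squares, and the determinant of a Lorentz matrix squares to one.\<close>

lemma det_spin_act:
  assumes "A \<in> SU11H"
  shows "det (matrix (spin_act A)) = 1"
proof -
  obtain c u D where 1: "c\<^sup>2 = 1 + (norm u)\<^sup>2" "c > 0" and D: "D \<in> Spin4"
    and A: "A = qmatmul (boost c u) D"
    using SU11H_decomposition[OF assms] by metis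
  obtain B where B: "B \<in> SU11H" "boost c u = qmatmul B B" using boost_sqrt[OF 1] by metis
  obtain E where E: "E \<in> Spin4" "D = qmatmul E E" using Spin4_sqrt[OF D] by metis
  show ?thesis
    using det_spin_act_square[OF B(1)] det_spin_act_square[OF Spin4_SU11H[OF E(1)]]
    by (simp add: A matrix_spin_act_qmatmul boost_SU11H 1 Spin4_SU11H D det_mul flip: B(2) E(2))
qed

section \<open>Lorentz matrices on the hyperboloid and identification of \<open>eta\<close>\<close>

lemma e5_nth [simp]: "qpart e5 = 0" "e5 $ 4 = 1"
  by (simp_all add: e5_hvec)

lemma matrix_44: "G $ 4 $ 4 = (G *v e5) $ 4" for G :: "real^5^5"
  by (simp add: e5_def matrix_vector_mult_basis column_def)

lemma matrix_spin_act_SOp41: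
  assumes "A \<in> SU11H"
  shows "matrix (spin_act A) \<in> SOp41"
proof -
  have "spin_act A e5 $ 4 > 0"
    using SU11H_00_nz[OF assms] by (simp add: spin_act_def qmul_linear add_pos_nonneg)
  then show ?thesis
    by (simp add: SOp41_def lorentz_spin_act assms det_spin_act matrix_44)
qed

text \<open>The sign of \<open>G$4$4\<close> only controls the image of \<open>e5\<close>. The
  product of \<open>x\<close> with \<open>e5\<close> is negative and is preserved, whereas by
  Cauchy-Schwarz a vector of square -1 with nonpositive last coordinate would have nonnegative
  product with \<open>G *v e5\<close>.\<close>

lemma SOp41_H4:
  assumes G: "G \<in> SOp41" and x: "x \<in> H4"
  shows "G *v x \<in> H4"
proof -
  let ?y = "G *v x" and ?z = "G *v e5"
  have l: "lorentz (G *v v) (G *v w) = lorentz v w" for v w using G by (simp add: SOp41_def)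
  have zp: "?z $ 4 > 0" using G by (simp add: SOp41_def matrix_44)
  have "lorentz ?y ?y = -1" using x by (simp add: l H4_lorentz)
  then have y2: "(norm (qpart ?y))\<^sup>2 = (?y$4)\<^sup>2 - 1"
    by (simp add: lorentz_qpart dot_square_norm power2_eq_square)
  have "lorentz ?z ?z = -1" by (simp add: l) (simp add: lorentz_qpart)
  then have z2: "(norm (qpart ?z))\<^sup>2 = (?z$4)\<^sup>2 - 1"
    by (simp add: lorentz_qpart dot_square_norm power2_eq_square)
  have "lorentz ?y ?z = - x$4" by (simp add: l) (simp add: lorentz_qpart)
  then have neg: "qpart ?y \<bullet> qpart ?z < ?y$4 * ?z$4" using x by (simp add: lorentz_qpart H4_lorentz)
  have "?y$4 > 0"
  proof (rule ccontr)
    assume "\<not> ?y$4 > 0"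
    then have yn: "?y$4 \<le> 0" by simp
    have "norm (qpart ?y) \<le> - ?y$4" by (rule power2_le_imp_le) (use y2 yn in auto)
    moreover have "norm (qpart ?z) \<le> ?z$4" by (rule power2_le_imp_le) (use z2 zp in auto)
    ultimately have "norm (qpart ?y) * norm (qpart ?z) \<le> - ?y$4 * ?z$4"
      using yn by (intro mult_mono) auto
    moreover have "\<bar>qpart ?y \<bullet> qpart ?z\<bar> \<le> norm (qpart ?y) * norm (qpart ?z)"
      by (rule Cauchy_Schwarz_ineq2)
    ultimately show False using neg by auto
  qed
  then show ?thesis using \<open>lorentz ?y ?y = -1\<close> by (simp add: H4_lorentz)
qed

lemma e5_H4: "e5 \<in> H4"
  by (simp add: H4_lorentz lorentz_qpart)

text \<open>The hyperboloid spans: a vector differs from the point of \<open>H4\<close> with the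
  same spatial part by a multiple of \<open>e5\<close>. This yields uniqueness in the definition of
  \<open>eta\<close>.\<close>

lemma linear_eq_on_H4:
  assumes "\<And>x. x \<in> H4 \<Longrightarrow> G *v x = H *v x"
  shows "G = H"
  unfolding matrix_eq
proof
  fix x :: "real^5"
  define s where "s = sqrt (1 + (norm (qpart x))\<^sup>2)"
  have s2: "s\<^sup>2 = 1 + (norm (qpart x))\<^sup>2" "s > 0" by (simp_all add: s_def add_pos_nonneg)
  then have "hvec (qpart x) s \<in> H4" by (simp add: H4_qpart)
  moreover have "x = hvec (qpart x) s + (x$4 - s) *\<^sub>R e5"
    by (simp add: vec5_eq_iff qpart_linear)
  ultimately show "G *v x = H *v x"
    by (metis assms e5_H4 matrix_vector_right_distrib matrix_vector_mult_scaleR)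
qed

lemma eta_spin_act:
  assumes "A \<in> SU11H"
  shows "eta A = matrix (spin_act A)"
  unfolding eta_def
proof (rule the_equality)
  show "matrix (spin_act A) \<in> SOp41 \<and> (\<forall>y\<in>ball 0 1. zeta (mob A y) = matrix (spin_act A) *v zeta y)"
    using matrix_spin_act_SOp41 zeta_mob assms by auto
next
  fix G assume G: "G \<in> SOp41 \<and> (\<forall>y\<in>ball 0 1. zeta (mob A y) = G *v zeta y)"
  show "G = matrix (spin_act A)"
  proof (rule linear_eq_on_H4)
    fix x assume "x \<in> H4"
    then show "G *v x = matrix (spin_act A) *v x"
      using G zeta_mob[OF assms zeta_inv_H4(1)] zeta_inv_H4 by (metis matrix_spin_act_mult mem_ball_0)
  qed
qed

lemma eta_mult [simp]: "A \<in> SU11H \<Longrightarrow> eta A *v x = spin_act A x"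
  by (simp add: eta_spin_act)

lemma eta_qmatmul: "A \<in> SU11H \<Longrightarrow> B \<in> SU11H \<Longrightarrow> eta (qmatmul A B) = eta A ** eta B"
  by (simp add: eta_spin_act SU11H_qmatmul matrix_spin_act_qmatmul)

lemma eta_qmat1: "eta qmat1 = mat 1"
  by (simp add: matrix_eq SU11H_qmat1)

lemma eta_SOp41: "A \<in> SU11H \<Longrightarrow> eta A \<in> SOp41"
  by (simp add: eta_spin_act matrix_spin_act_SOp41)

subsection \<open>Surjectivity of the spin covering\<close>

text \<open>The alternative with \<open>qcnj\<close> is the orientation-reversing half of O(4). Both
  halves are kept together because a reflection exchanges them.\<close>

definition is_quat_isometry :: "(quat \<Rightarrow> quat) \<Rightarrow> bool" where
  "is_quat_isometry f \<longleftrightarrow> (\<exists>p q. norm p = 1 \<and> norm q = 1 \<and>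
     ((\<forall>y. f y = p \<odot> y \<odot> qcnj q) \<or> (\<forall>y. f y = p \<odot> qcnj y \<odot> qcnj q)))"

definition reflection :: "quat \<Rightarrow> quat \<Rightarrow> quat" where
  "reflection w y = y - (2 * (w \<bullet> y)) *\<^sub>R w"

lemma reflection_qmul: "norm w = 1 \<Longrightarrow> reflection w y = - (w \<odot> qcnj y \<odot> w)"
  by (simp add: reflection_def sandwich_qcnj qmul_assoc)

lemma reflection_reflection: "norm w = 1 \<Longrightarrow> reflection w (reflection w y) = y"
  by (simp add: reflection_def inner_diff_right dot_square_norm algebra_simps)

lemma orthogonal_reflection: "norm w = 1 \<Longrightarrow> orthogonal_transformation (reflection w)"
  unfolding orthogonal_transformation_def
proof (intro conjI allI)
  show "linear (reflection w)"
    by (rule linearI) (simp_all add: reflection_def inner_add_right algebra_simps)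
  fix a b assume "norm w = 1"
  then show "reflection w a \<bullet> reflection w b = a \<bullet> b"
    by (simp add: reflection_def inner_diff_left inner_diff_right dot_square_norm inner_commute[of a w])
qed

text \<open>Reflections are involutions, so f is recovered by reflecting once more. Since the
  reflection is y \<mapsto> -w y* w, it turns one form into the other, with unit factors -(w q) and
  w* p.\<close>

lemma is_quat_isometry_reflection:
  assumes "norm w = 1" and "is_quat_isometry (\<lambda>y. reflection w (f y))"
  shows "is_quat_isometry f"
proof -
  obtain p q where pq: "norm p = 1" "norm q = 1"
    and "(\<forall>y. reflection w (f y) = p \<odot> y \<odot> qcnj q) \<or> (\<forall>y. reflection w (f y) = p \<odot> qcnj y \<odot> qcnj q)"
    using assms(2) unfolding is_quat_isometry_def by blast
  then consider "\<forall>y. reflection w (f y) = p \<odot> y \<odot> qcnj q" | "\<forall>y. reflection w (f y) = p \<odot> qcnj y \<odot> qcnj q"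
    by blast
  then show ?thesis
  proof cases
    case 1
    have "f y = (- (w \<odot> q)) \<odot> qcnj y \<odot> qcnj (qcnj w \<odot> p)" for y
    proof -
      have "f y = reflection w (reflection w (f y))" by (simp only: reflection_reflection assms(1))
      then show ?thesis
        unfolding 1[rule_format]
        by (simp add: reflection_qmul[OF assms(1)] qmul_linear qmul_assoc qcnj_qmul)
    qed
    moreover have "norm (- (w \<odot> q)) = 1" "norm (qcnj w \<odot> p) = 1" using assms(1) pq by (simp_all add: norm_qmul)
    ultimately show ?thesis unfolding is_quat_isometry_def by blast
  next
    case 2
    have "f y = (- (w \<odot> q)) \<odot> y \<odot> qcnj (qcnj w \<odot> p)" for y
    proof -
      have "f y = reflection w (reflection w (f y))" by (simp only: reflection_reflection assms(1))
      then show ?thesis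
        unfolding 2[rule_format]
        by (simp add: reflection_qmul[OF assms(1)] qmul_linear qmul_assoc qcnj_qmul)
    qed
    moreover have "norm (- (w \<odot> q)) = 1" "norm (qcnj w \<odot> p) = 1" using assms(1) pq by (simp_all add: norm_qmul)
    ultimately show ?thesis unfolding is_quat_isometry_def by blast
  qed
qed

lemma reflection_swap:
  assumes "norm v = norm e" "v \<noteq> e"
  shows "reflection ((1 / norm (v - e)) *\<^sub>R (v - e)) v = e"
proof -
  let ?n = "norm (v - e)"
  have n: "?n \<noteq> 0" using assms(2) by simp
  have e: "?n\<^sup>2 = 2 * ((v - e) \<bullet> v)"
    using assms(1) by (simp add: power2_norm_eq_inner inner_diff_left inner_diff_right inner_commute[of e v])
      (simp add: dot_square_norm)
  have "2 * (((1 / ?n) *\<^sub>R (v - e)) \<bullet> v) * (1 / ?n) = 2 * ((v - e) \<bullet> v) / ?n\<^sup>2"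
    by (simp add: power2_eq_square)
  also have "\<dots> = 1" unfolding e[symmetric] using n by simp
  finally show ?thesis by (simp only: reflection_def scaleR_scaleR scaleR_one) simp
qed

text \<open>Composing with reflections makes $f$ fix the coordinate axes one after another.\<close>

lemma orthogonal_is_quat_isometry:
  assumes "orthogonal_transformation f"
  shows "is_quat_isometry f"
proof -
  have "\<forall>f. orthogonal_transformation f \<and> (\<forall>i. i \<notin> K \<longrightarrow> f (axis i 1) = axis i 1) \<longrightarrow> is_quat_isometry f"
    if "finite K" for K :: "4 set"
    using that
  proof (induction K)
    case empty
    show ?case
    proof (intro allI impI)
      fix f :: "quat \<Rightarrow> quat"
      assume f: "orthogonal_transformation f \<and> (\<forall>i. i \<notin> {} \<longrightarrow> f (axis i 1) = axis i 1)"
      have "f y = y" for y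
        by (rule linear_eq_on_span[of f "\<lambda>y. y" Basis, simplified])
          (use f in \<open>auto simp: orthogonal_transformation_def linear_ident Basis_vec_def\<close>)
      then show "is_quat_isometry f"
        unfolding is_quat_isometry_def by (intro exI[of _ qone]) simp
    qed
  next
    case (insert k K)
    show ?case
    proof (intro allI impI)
      fix f :: "quat \<Rightarrow> quat"
      assume "orthogonal_transformation f \<and> (\<forall>i. i \<notin> insert k K \<longrightarrow> f (axis i 1) = axis i 1)"
      then have f: "orthogonal_transformation f" and fx: "\<And>i. i \<notin> insert k K \<Longrightarrow> f (axis i 1) = axis i 1"
        by auto
      let ?v = "f (axis k 1)"
      show "is_quat_isometry f"
      proof (cases "?v = axis k 1")
        case True
        then show ?thesis using insert.IH f fx by (metis insert_iff)
      next
        case False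
        define w where "w = (1 / norm (?v - axis k 1)) *\<^sub>R (?v - axis k 1)"
        have w: "norm w = 1" using False by (simp add: w_def)
        let ?g = "\<lambda>y. reflection w (f y)"
        have "?g (axis k 1) = axis k 1"
          unfolding w_def by (rule reflection_swap)
            (use f False in \<open>auto simp: orthogonal_transformation_norm\<close>)
        moreover have "?g (axis i 1) = axis i 1" if i: "i \<notin> insert k K" for i
        proof -
          \<comment> \<open>An axis already fixed has the same product with \<open>?v\<close> as
            with axis k, because f preserves products; hence it is orthogonal to w and the new
            reflection leaves it fixed.\<close>
          have "axis i 1 \<bullet> ?v = axis i 1 \<bullet> (axis k 1 :: quat)"
            using fx[OF i] f unfolding orthogonal_transformation_def by metis
          then have "axis i 1 \<bullet> w = 0" by (simp add: w_def inner_diff_right)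
          then have "w \<bullet> axis i 1 = 0" by (simp only: inner_commute)
          then show ?thesis by (simp add: fx[OF i] reflection_def)
        qed
        moreover have "orthogonal_transformation ?g"
          using orthogonal_transformation_compose[OF orthogonal_reflection[OF w] f] by (simp add: o_def)
        ultimately have "orthogonal_transformation ?g \<and> (\<forall>i. i \<notin> K \<longrightarrow> ?g (axis i 1) = axis i 1)"
          by (metis insertE)
        then have "is_quat_isometry ?g" by (rule insert.IH[rule_format])
        then show ?thesis by (rule is_quat_isometry_reflection[OF w])
      qed
    qed
  qed
  from this[of UNIV] show ?thesis using assms by simp
qed

section \<open>Transitivity, stabilizers and lifts\<close>

lemma hyperbolic_transitive:
  assumes "x \<in> H4"
  obtains A where "A \<in> SU11H" "spin_act A e5 = x"
proof -
  \<comment> \<open>A boost sends \<open>e5\<close> to the vector with spatial part 2 c u and last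
    coordinate 2 c^2 - 1; these values solve for \<open>x\<close>.\<close>
  define c where "c = sqrt ((x$4 + 1) / 2)"
  define u where "u = (1 / (2 * c)) *\<^sub>R qpart x"
  have t: "x$4 > 0" "(norm (qpart x))\<^sup>2 = (x$4)\<^sup>2 - 1" using assms by (auto simp: H4_qpart)
  then have c: "c > 0" "c\<^sup>2 = (x$4 + 1) / 2" by (simp_all add: c_def)
  have "(norm u)\<^sup>2 = ((x$4)\<^sup>2 - 1) / (4 * c\<^sup>2)"
    by (simp add: u_def power_mult_distrib power_divide t)
  also have "\<dots> = (x$4 - 1) / 2"
    unfolding c using t(1) by (simp add: field_simps power2_eq_square)
  finally have cu: "c\<^sup>2 = 1 + (norm u)\<^sup>2" using c by (simp add: field_simps)
  have "spin_act (boost c u) e5 = x"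
    using c unfolding spin_act_boost[OF cu] by (simp add: vec5_eq_iff u_def power2_eq_square)
  then show thesis using that boost_SU11H[OF cu] by blast
qed

lemma stabilizer_Spin4:
  assumes "A \<in> SU11H" "spin_act A e5 = e5"
  shows "A \<in> Spin4"
proof -
  note r = SU11H_rels[OF assms(1)]
  have "(norm (A$0$0))\<^sup>2 + (norm (A$0$1))\<^sup>2 = 1"
    using arg_cong[OF assms(2), of "\<lambda>x. x$4"] by (simp add: spin_act_def qmul_linear)
  then have "A$0$1 = 0" "(norm (A$0$0))\<^sup>2 = 1\<^sup>2" using r(3) by auto
  moreover from this(2) have "norm (A$0$0) = 1" by (rule power2_eq_imp_eq) simp_all
  ultimately show ?thesis using r by (simp add: Spin4_def)
qed

text \<open>A Lorentz matrix fixing \<open>e5\<close> preserves the last coordinate and acts on the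
  spatial part by an orthogonal map f. The quaternionic form of f yields the lift, and determinant 1
  rules out the form with conjugation.\<close>

lemma SOp41_stabilizer:
  assumes G: "G \<in> SOp41" and fx: "G *v e5 = e5"
  obtains D where "D \<in> Spin4" "G = eta D"
proof -
  have l: "lorentz (G *v v) (G *v w) = lorentz v w" for v w using G by (simp add: SOp41_def)
  define f where "f y = qpart (G *v hvec y 0)" for y
  have h0: "hvec (a + b) 0 = hvec a 0 + hvec b 0" "hvec (r *\<^sub>R a) 0 = r *\<^sub>R hvec a 0" for a b r
    by (simp_all add: vec5_eq_iff qpart_linear)
  have G4: "(G *v x) $ 4 = x $ 4" for x
    using l[of x e5] by (simp add: fx lorentz_qpart)
  have Gx: "G *v x = hvec (f (qpart x)) (x$4)" for x
  proof -
    have x: "x = hvec (qpart x) 0 + x$4 *\<^sub>R e5" by (simp add: vec5_eq_iff qpart_linear)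
    have "qpart (G *v x) = f (qpart x)"
      by (subst x) (simp add: matrix_vector_right_distrib matrix_vector_mult_scaleR fx qpart_linear f_def)
    then show ?thesis by (simp add: vec5_eq_iff G4)
  qed
  have "orthogonal_transformation f"
    unfolding orthogonal_transformation_def
  proof (intro conjI allI)
    show "linear f"
      by (rule linearI)
        (simp_all add: f_def h0 matrix_vector_right_distrib matrix_vector_mult_scaleR qpart_linear)
    show "f v \<bullet> f w = v \<bullet> w" for v w
      using l[of "hvec v 0" "hvec w 0"] by (simp add: Gx lorentz_qpart)
  qed
  then obtain p q where pq: "norm p = 1" "norm q = 1"
    and "(\<forall>y. f y = p \<odot> y \<odot> qcnj q) \<or> (\<forall>y. f y = p \<odot> qcnj y \<odot> qcnj q)"
    using orthogonal_is_quat_isometry unfolding is_quat_isometry_def by blast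
  then consider "\<forall>y. f y = p \<odot> y \<odot> qcnj q" | "\<forall>y. f y = p \<odot> qcnj y \<odot> qcnj q" by blast
  then show thesis
  proof cases
    case 1
    let ?D = "qmat_of p 0 0 q"
    have D: "?D \<in> Spin4" using pq by (simp add: Spin4_def)
    have "G = eta ?D"
      unfolding matrix_eq using 1 by (simp add: Gx Spin4_SU11H[OF D] spin_act_Spin4[OF D])
    with D show thesis by (rule that)
  next
    case 2
    let ?D = "qmat_of p 0 0 q"
    have D: "?D \<in> Spin4" using pq by (simp add: Spin4_def)
    \<comment> \<open>Quaternion conjugation on the spatial part: three sign changes, so determinant
      -1.\<close>
    define C :: "real^5^5" where "C = (\<chi> i j. if i = j then (if i = 0 \<or> i = 4 then 1 else -1) else 0)"
    have C: "C *v x = hvec (qcnj (qpart x)) (x$4)" for x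
      unfolding vec_eq_iff forall_5_from_0 matrix_vector_mult_def UNIV_5_from_0
      by (simp add: C_def hvec_nth qcnj_nth qpart_nth)
    have "det C = (\<Prod>i\<in>UNIV. C$i$i)"
      by (rule det_diagonal) (simp add: C_def)
    also have "\<dots> = -1" unfolding UNIV_5_from_0 by (simp add: C_def)
    finally have "det C = -1" .
    have "G = eta ?D ** C"
      unfolding matrix_eq using 2
      by (simp add: Gx Spin4_SU11H[OF D] spin_act_Spin4[OF D] C flip: matrix_vector_mul_assoc)
    then have "det G = -1"
      using eta_SOp41[OF Spin4_SU11H[OF D]] \<open>det C = -1\<close> by (simp add: det_mul SOp41_def)
    then show thesis using G by (simp add: SOp41_def)
  qed
qed

lemma SOp41_matmul:
  assumes "G \<in> SOp41" "H \<in> SOp41"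
  shows "G ** H \<in> SOp41"
proof -
  have "G *v (H *v e5) \<in> H4" using assms SOp41_H4 e5_H4 by blast
  then show ?thesis
    using assms by (simp add: SOp41_def det_mul matrix_44 H4_lorentz flip: matrix_vector_mul_assoc)
qed

text \<open>A lift of some element carrying \<open>e5\<close> to \<open>G *v e5\<close> reduces G to
  the stabilizer of \<open>e5\<close>. This provides the lift of the arbitrarily chosen
  \<open>g\<close> in \<open>nu\<close>.\<close>

lemma eta_surj:
  assumes G: "G \<in> SOp41"
  obtains A where "A \<in> SU11H" "eta A = G"
proof -
  obtain B where B: "B \<in> SU11H" "spin_act B e5 = G *v e5"
    using hyperbolic_transitive[OF SOp41_H4[OF G e5_H4]] .
  let ?H = "eta (qmat_inv B) ** G"
  have "?H \<in> SOp41" using B G by (simp add: SOp41_matmul eta_SOp41)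
  moreover have "?H *v e5 = e5"
    using B by (simp flip: matrix_vector_mul_assoc B(2))
  ultimately obtain D where D: "D \<in> Spin4" "?H = eta D" by (rule SOp41_stabilizer)
  have "eta (qmatmul B D) = eta (qmatmul B (qmat_inv B)) ** G"
    using B D by (simp only: eta_qmatmul Spin4_SU11H qmat_inv_SU11H flip: D(2) matrix_mul_assoc)
  also have "\<dots> = G" using B by (simp add: eta_qmat1)
  finally show thesis using that B D by (metis SU11H_qmatmul Spin4_SU11H)
qed

subsection \<open>The determinant of the differential\<close>

lemma linear_qmul_left: "linear (\<lambda>y. p \<odot> y)" and linear_qmul_right: "linear (\<lambda>y. y \<odot> q)"
  by (rule linearI, simp_all add: qmul_linear)+

lemma abs_det_qmul_right:
  assumes "norm q = 1"
  shows "\<bar>det (matrix (\<lambda>y. y \<odot> q))\<bar> = 1"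
  by (rule orthogonal_transformation_det)
    (use assms in \<open>simp add: orthogonal_transformation_def linear_qmul_right inner_qmul_qmul\<close>)

lemma det_compose_linear:
  fixes f g :: "real^'n \<Rightarrow> real^'n"
  shows "linear f \<Longrightarrow> linear g \<Longrightarrow> det (matrix (\<lambda>x. f (g x))) = det (matrix f) * det (matrix g)"
  using matrix_compose[of g f] by (simp add: o_def det_mul)

text \<open>A nonzero imaginary u orthogonal to the imaginary part of p anticommutes with it. If
  that part is a multiple of k, then i serves; otherwise rotate its (i, j) component by a quarter
  turn.\<close>

lemma qcnj_conjugate:
  obtains u where "u \<noteq> 0" "u \<odot> p = qcnj p \<odot> u"
proof (cases "p$1 = 0 \<and> p$2 = 0")
  case True
  then show thesis
    by (intro that[of "axis 1 1"]) (simp_all add: quat_eq_iff quat_nth axis_def)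
next
  case False
  then show thesis
    by (intro that[of "\<chi> i. if i = 1 then p$2 else if i = 2 then - p$1 else 0"]) (auto simp: quat_eq_iff quat_nth)
qed

text \<open>Up to a unit factor the determinant is that of $S_p: y \mapsto y q - p y$. Here $S_p S_{\bar p}$ is
  $2(\mathrm{Re} q - \mathrm{Re} p)$ times right multiplication by $q$, and $S_{\bar p}$ is conjugate to $S_p$
  since $\bar p$ is conjugate to $p$.\<close>

lemma abs_det_one_minus:
  assumes "norm p = 1" "norm q = 1"
  shows "\<bar>det (matrix (\<lambda>y. y - p \<odot> y \<odot> qcnj q))\<bar> = 4 * (qRe p - qRe q)\<^sup>2"
proof -
  define S where "S r y = y \<odot> q - r \<odot> y" for r y
  have lin: "linear (S r)" for r
    by (rule linearI) (simp_all add: S_def qmul_linear algebra_simps)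
  have SS: "S p (S (qcnj p) y) = (2 * (qRe q - qRe p)) *\<^sub>R (y \<odot> q)" for y
  proof -
    have "S p (S (qcnj p) y) = y \<odot> (q \<odot> q) - (p + qcnj p) \<odot> (y \<odot> q) + y"
      by (simp add: S_def qmul_linear qmul_assoc qmul_qcnj_cancel assms)
    then show ?thesis
      unfolding qmul_self[of q] add_qcnj assms by (simp add: qmul_linear algebra_simps)
  qed
  have "det (matrix (S p)) * det (matrix (S (qcnj p))) = det (matrix (\<lambda>y. (2 * (qRe q - qRe p)) *\<^sub>R (y \<odot> q)))"
    by (simp only: SS flip: det_compose_linear[OF lin lin])
  also have "\<dots> = (2 * (qRe q - qRe p)) ^ 4 * det (matrix (\<lambda>y. y \<odot> q))"
    by (subst det_compose_linear[OF linear_scale_self linear_qmul_right]) simp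
  also have "(2 * (qRe q - qRe p)) ^ 4 = (4 * (qRe p - qRe q)\<^sup>2)\<^sup>2"
    by (simp add: power2_eq_square power4_eq_xxxx algebra_simps)
  finally have 1: "\<bar>det (matrix (S p)) * det (matrix (S (qcnj p)))\<bar> = (4 * (qRe p - qRe q)\<^sup>2)\<^sup>2"
    by (simp add: abs_mult abs_det_qmul_right assms)
  obtain u where u: "u \<noteq> 0" "u \<odot> p = qcnj p \<odot> u" using qcnj_conjugate .
  have "det (matrix (\<lambda>y. qcnj u \<odot> y)) * det (matrix (\<lambda>y. u \<odot> y)) = ((norm u)\<^sup>2) ^ 4"
    using det_matrix_scaleR[of "(norm u)\<^sup>2", where 'n = 4]
    by (simp add: qmul_qcnj_cancel flip: det_compose_linear[OF linear_qmul_left linear_qmul_left])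
  then have u0: "det (matrix (\<lambda>y. u \<odot> y)) \<noteq> 0" using u(1) by auto
  have "(\<lambda>y. u \<odot> S p y) = (\<lambda>y. S (qcnj p) (u \<odot> y))"
    by (simp add: S_def qmul_linear fun_eq_iff flip: u(2) qmul_assoc)
  then have "det (matrix (\<lambda>y. u \<odot> y)) * det (matrix (S p)) = det (matrix (S (qcnj p))) * det (matrix (\<lambda>y. u \<odot> y))"
    by (simp only: lin linear_qmul_left flip: det_compose_linear)
  then have "det (matrix (S (qcnj p))) = det (matrix (S p))" using u0 by simp
  with 1 have "\<bar>det (matrix (S p))\<bar>\<^sup>2 = (4 * (qRe p - qRe q)\<^sup>2)\<^sup>2"
    by (simp add: power2_eq_square)
  then have 2: "\<bar>det (matrix (S p))\<bar> = 4 * (qRe p - qRe q)\<^sup>2"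
    by (rule power2_eq_imp_eq) simp_all
  have "y - p \<odot> y \<odot> qcnj q = S p y \<odot> qcnj q" for y
    by (simp add: S_def qmul_linear qmul_assoc qmul_qcnj assms)
  then show ?thesis
    by (simp add: det_compose_linear[OF linear_qmul_right lin] abs_mult abs_det_qmul_right assms 2)
qed

subsection \<open>Freeness of the action\<close>

lemma tendsto_matrix_mult:
  fixes A B :: "nat \<Rightarrow> real^'n^'n"
  assumes "A \<longlonglongrightarrow> a" "B \<longlonglongrightarrow> b"
  shows "(\<lambda>k. A k ** B k) \<longlonglongrightarrow> a ** b"
  unfolding matrix_matrix_mult_def
  by (intro vec_tendstoI) (auto intro!: tendsto_intros assms)

lemma tendsto_transpose:
  fixes A :: "nat \<Rightarrow> real^'n^'n"
  assumes "A \<longlonglongrightarrow> a"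
  shows "(\<lambda>k. transpose (A k)) \<longlonglongrightarrow> transpose a"
  unfolding transpose_def
  by (intro vec_tendstoI) (auto intro!: tendsto_intros assms)

lemma norm_orthogonal_matrix_le:
  fixes A :: "real^'n^'n"
  assumes "orthogonal_matrix A"
  shows "norm A \<le> CARD('n)"
proof -
  have "norm (A $ i) = 1" for i
    using assms by (simp add: orthogonal_matrix_orthonormal_rows row_def)
  moreover have "norm A \<le> (\<Sum>i\<in>UNIV. norm (A $ i))"
    unfolding norm_vec_def[of A] by (rule L2_set_le_sum) simp
  ultimately show ?thesis by simp
qed

text \<open>By compactness of the orthogonal group, some subsequence of the powers converges, and quotients
  of consecutive terms of that subsequence tend to the identity.\<close>

lemma orthogonal_powers_recurrent:
  fixes h :: "nat \<Rightarrow> real^'n^'n"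
  assumes orth: "\<And>n. orthogonal_matrix (h n)" and add: "\<And>m n. h (m + n) = h m ** h n"
  obtains d :: "nat \<Rightarrow> nat" where "\<And>n. d n > 0" "(\<lambda>n. h (d n)) \<longlonglongrightarrow> mat 1"
proof -
  have "bounded (range h)"
    using norm_orthogonal_matrix_le[OF orth] by (auto simp: bounded_iff)
  then obtain l r where r: "strict_mono r" and l: "(h \<circ> r) \<longlonglongrightarrow> l"
    using bounded_imp_convergent_subsequence by blast
  have l0: "(\<lambda>n. h (r n)) \<longlonglongrightarrow> l" using l by (simp add: o_def)
  then have l1: "(\<lambda>n. h (r (Suc n))) \<longlonglongrightarrow> l" by (rule LIMSEQ_Suc)
  have inv: "transpose (h n) ** h n = mat 1" for n using orth by (simp add: orthogonal_matrix)
  have "(\<lambda>n. transpose (h (r n)) ** h (r n)) \<longlonglongrightarrow> transpose l ** l"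
    by (intro tendsto_matrix_mult tendsto_transpose l0)
  then have "transpose l ** l = mat 1" by (simp add: inv LIMSEQ_const_iff)
  moreover have "(\<lambda>n. transpose (h (r n)) ** h (r (Suc n))) \<longlonglongrightarrow> transpose l ** l"
    by (intro tendsto_matrix_mult tendsto_transpose l0 l1)
  moreover have lt: "r n < r (Suc n)" for n using r by (simp add: strict_mono_Suc_iff)
  moreover have "transpose (h (r n)) ** h (r (Suc n)) = h (r (Suc n) - r n)" for n
  proof -
    have "h (r (Suc n)) = h (r n) ** h (r (Suc n) - r n)"
      using lt[of n] by (simp flip: add)
    then show ?thesis by (simp add: matrix_mul_assoc inv)
  qed
  ultimately show thesis by (intro that[of "\<lambda>n. r (Suc n) - r n"]) simp_all
qed

text \<open>\<open>Spin4\<close> preserves the spatial norm and the last coordinate separately,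
  hence the Euclidean norm. This places the stabilizer of \<open>e5\<close> inside a compact
  group.\<close>

lemma orthogonal_matrix_stabilizer:
  assumes "D \<in> Spin4"
  shows "orthogonal_matrix (eta D)"
proof -
  have n: "norm (hvec q t) = sqrt ((norm q)\<^sup>2 + t\<^sup>2)" for q t
  proof -
    have "(norm (hvec q t))\<^sup>2 = (norm q)\<^sup>2 + t\<^sup>2"
      unfolding norm_quat power2_norm_eq_inner inner_vec_def UNIV_5_from_0
      by (simp add: hvec_nth power2_eq_square)
    then show ?thesis by (metis norm_ge_zero real_sqrt_unique)
  qed
  have "norm (spin_act D x) = norm x" for x
  proof -
    have "norm x = sqrt ((norm (qpart x))\<^sup>2 + (x$4)\<^sup>2)" using n[of "qpart x" "x$4"] by simp
    then show ?thesis
      using assms unfolding spin_act_Spin4[OF assms] n by (simp add: norm_qmul Spin4_def)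
  qed
  then have "orthogonal_transformation (spin_act D)"
    by (simp add: orthogonal_transformation linear_spin_act)
  then show ?thesis
    by (simp add: eta_spin_act Spin4_SU11H assms orthogonal_transformation_matrix)
qed

text \<open>Conjugated to fix \<open>e5\<close>, the powers of \<gamma> become orthogonal matrices,
  so some positive powers tend to the identity. Discreteness makes one of them equal to it, and
  torsion-freeness then applies.\<close>

lemma discrete_torsion_free_acts_freely:
  assumes sub: "\<Gamma> \<subseteq> SOp41" and grp: "mat_subgroup \<Gamma>" and disc: "discrete_set \<Gamma>"
    and tf: "torsion_free \<Gamma>" and \<gamma>: "\<gamma> \<in> \<Gamma>" and x: "x \<in> H4" and fx: "\<gamma> *v x = x"
  shows "\<gamma> = mat 1"
proof -
  define pw where "pw n = (((**) \<gamma>) ^^ n) (mat 1)" for n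
  have pw0: "pw 0 = mat 1" and pwS: "pw (Suc n) = \<gamma> ** pw n" for n by (simp_all add: pw_def)
  have pwG: "pw n \<in> \<Gamma>" for n
    using grp \<gamma> by (induction n) (auto simp: pw0 pwS mat_subgroup_def)
  have pw_add: "pw (m + n) = pw m ** pw n" for m n
    by (induction m) (simp_all add: pw0 pwS matrix_mul_assoc)
  have pw_fx: "pw n *v x = x" for n
    by (induction n) (simp_all add: pw0 pwS fx flip: matrix_vector_mul_assoc)
  obtain A where A: "A \<in> SU11H" "spin_act A e5 = x" using hyperbolic_transitive[OF x] .
  define a where "a = eta A"
  define b where "b = eta (qmat_inv A)"
  have ab: "a ** b = mat 1" "b ** a = mat 1"
    using A by (simp_all add: a_def b_def eta_qmat1 flip: eta_qmatmul)
  define h where "h n = b ** pw n ** a" for n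
  have orth: "orthogonal_matrix (h n)" for n
  proof -
    have "h n \<in> SOp41"
      unfolding h_def a_def b_def using A pwG sub by (auto intro!: SOp41_matmul eta_SOp41)
    moreover have "h n *v e5 = e5"
      using A pw_fx[of n] by (simp add: h_def a_def b_def flip: matrix_vector_mul_assoc)
        (simp flip: A(2))
    ultimately obtain D where "D \<in> Spin4" "h n = eta D" by (rule SOp41_stabilizer)
    then show ?thesis by (simp add: orthogonal_matrix_stabilizer)
  qed
  have add: "h (m + n) = h m ** h n" for m n
  proof -
    have "h m ** h n = b ** pw m ** (a ** b) ** pw n ** a" by (simp add: h_def matrix_mul_assoc)
    then show ?thesis by (simp add: ab h_def pw_add matrix_mul_assoc)
  qed
  obtain d where d: "\<And>n. d n > 0" "(\<lambda>n. h (d n)) \<longlonglongrightarrow> mat 1"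
    using orthogonal_powers_recurrent[of h, OF orth add] by blast
  have "(\<lambda>n. a ** h (d n) ** b) \<longlonglongrightarrow> a ** mat 1 ** b"
    by (intro tendsto_matrix_mult d tendsto_const)
  moreover have "a ** h n ** b = pw n" for n
  proof -
    have "a ** h n ** b = (a ** b) ** pw n ** (a ** b)" by (simp add: h_def matrix_mul_assoc)
    then show ?thesis by (simp add: ab)
  qed
  ultimately have lim: "(\<lambda>n. pw (d n)) \<longlonglongrightarrow> mat 1" by (simp add: ab)
  obtain e where "e > 0" and e: "\<And>h. h \<in> \<Gamma> \<Longrightarrow> dist h (mat 1) < e \<Longrightarrow> h = mat 1"
    using disc grp unfolding discrete_set_def mat_subgroup_def by blast
  obtain n where "dist (pw (d n)) (mat 1) < e"
    using tendstoD[OF lim \<open>e > 0\<close>] eventually_sequentially by fastforce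
  then have "pw (d n) = mat 1" using e pwG by blast
  then show ?thesis using tf \<gamma> d(1)[of n] unfolding torsion_free_def pw_def by blast
qed

subsection \<open>The action in the ball model\<close>

text \<open>On the open unit ball this agrees with \<open>mob A\<close>, but it has exactly the
  shape of the map differentiated in \<open>nu\<close>, and linearity of \<open>spin_act\<close>
  makes differentiability immediate.\<close>

definition ball_act :: "qmat \<Rightarrow> quat \<Rightarrow> quat" where
  "ball_act A y = zeta_inv (spin_act A (zeta y))"

lemma spin_act_H4: "A \<in> SU11H \<Longrightarrow> x \<in> H4 \<Longrightarrow> spin_act A x \<in> H4"
  using SOp41_H4[OF eta_SOp41] by fastforce

lemma norm_ball_act: "A \<in> SU11H \<Longrightarrow> norm y < 1 \<Longrightarrow> norm (ball_act A y) < 1"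
  by (simp add: ball_act_def zeta_inv_H4 spin_act_H4 zeta_in_H4)

lemma ball_act_qmatmul:
  "A \<in> SU11H \<Longrightarrow> B \<in> SU11H \<Longrightarrow> norm y < 1 \<Longrightarrow> ball_act (qmatmul A B) y = ball_act A (ball_act B y)"
  by (simp add: ball_act_def zeta_inv_H4 spin_act_H4 zeta_in_H4 spin_act_qmatmul)

lemma ball_act_qmat1: "norm y < 1 \<Longrightarrow> ball_act qmat1 y = y"
  by (simp add: ball_act_def zeta_inv_zeta)

lemma ball_act_Spin4:
  assumes D: "D \<in> Spin4" and y: "norm y < 1"
  shows "ball_act D y = D$0$0 \<odot> y \<odot> qcnj (D$1$1)"
proof -
  have "norm (D$0$0 \<odot> y \<odot> qcnj (D$1$1)) = norm y"
    using D by (simp add: norm_qmul Spin4_def)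
  then have "spin_act D (zeta y) = zeta (D$0$0 \<odot> y \<odot> qcnj (D$1$1))"
    unfolding spin_act_Spin4[OF D] zeta_hvec by (simp add: qmul_linear)
  then show ?thesis
    unfolding ball_act_def using zeta_inv_zeta y \<open>norm _ = norm y\<close> by simp
qed

lemma differentiable_scaleR_fun:
  "f differentiable (at x within S) \<Longrightarrow> g differentiable (at x within S)
    \<Longrightarrow> (\<lambda>x. f x *\<^sub>R g x) differentiable (at x within S)"
  unfolding differentiable_def using has_derivative_scaleR by blast

lemma linear_imp_differentiable_comp:
  fixes f :: "'a::euclidean_space \<Rightarrow> 'b::real_normed_vector"
  shows "linear f \<Longrightarrow> g differentiable F \<Longrightarrow> (\<lambda>x. f (g x)) differentiable F"
  unfolding differentiable_def
  using bounded_linear.has_derivative[OF linear_conv_bounded_linear[THEN iffD1]] by blast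

lemma ball_act_differentiable:
  assumes A: "A \<in> SU11H" and y: "norm y < 1"
  shows "ball_act A differentiable (at y)"
proof -
  have lin: "linear (\<lambda>q. hvec q 0)"
    by (rule linearI) (simp_all add: vec5_eq_iff qpart_linear)
  have nz: "1 - (norm y)\<^sup>2 \<noteq> 0" using norm2_lt_1[OF y] by simp
  have z: "zeta = (\<lambda>y. (2 / (1 - (norm y)\<^sup>2)) *\<^sub>R hvec y 0 + ((1 + (norm y)\<^sup>2) / (1 - (norm y)\<^sup>2)) *\<^sub>R e5)"
    by (rule ext) (simp add: zeta_hvec vec5_eq_iff qpart_linear)
  have dz: "zeta differentiable (at y)"
    unfolding z using nz
    by (intro differentiable_add differentiable_scaleR_fun differentiable_divide differentiable_diff
        differentiable_const differentiable_sqnorm_at linear_imp_differentiable_comp[OF lin] differentiable_ident)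
  have d1: "(\<lambda>y. spin_act A (zeta y)) differentiable (at y)"
    by (rule linear_imp_differentiable_comp[OF linear_spin_act dz])
  have lq: "linear qpart" and l4: "linear (\<lambda>x::real^5. x$4)"
    by (rule linearI, simp_all add: qpart_linear)+
  have "spin_act A (zeta y) $ 4 > 0"
    using spin_act_H4[OF A zeta_in_H4[OF y]] by (simp add: H4_qpart)
  then show ?thesis
    unfolding ball_act_def[abs_def] zeta_inv_qpart
    by (intro differentiable_scaleR_fun differentiable_divide differentiable_add differentiable_const
        linear_imp_differentiable_comp[OF lq d1] linear_imp_differentiable_comp[OF l4 d1]) simp
qed

text \<open>Conjugation by g moves the fixed point to the origin, where the action of s is the
  linear map R. By the chain rule the differential is P R Q with P Q = 1, so I - P R Q and I - R
  have the same determinant.\<close>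

lemma abs_det_ball_act_fixed_point:
  assumes g: "g \<in> SU11H" and s: "s \<in> Spin4"
    and M: "M = qmatmul g (qmatmul s (qmat_inv g))" and y0: "y0 = ball_act g 0"
  shows "\<bar>det (matrix (\<lambda>v. v - frechet_derivative (ball_act M) (at y0) v))\<bar>
      = 4 * (qRe (s$0$0) - qRe (s$1$1))\<^sup>2"
proof -
  define R where "R v = s$0$0 \<odot> v \<odot> qcnj (s$1$1)" for v
  note sSU = Spin4_SU11H[OF s]
  have y0n: "norm y0 < 1" using norm_ball_act[OF g, of 0] by (simp add: y0)
  have gy0: "ball_act (qmat_inv g) y0 = 0"
    using ball_act_qmatmul[OF qmat_inv_SU11H[OF g] g, of 0] by (simp add: y0 g ball_act_qmat1)
  obtain P where P: "(ball_act g has_derivative P) (at 0)"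
    using ball_act_differentiable[OF g, of 0] by (auto simp: differentiable_def)
  obtain Q where Q: "(ball_act (qmat_inv g) has_derivative Q) (at y0)"
    using ball_act_differentiable[OF qmat_inv_SU11H[OF g] y0n] by (auto simp: differentiable_def)
  have linP: "linear P" and linQ: "linear Q" using P Q has_derivative_linear by auto
  have linR: "linear R"
    by (rule linearI) (simp_all add: R_def qmul_linear)
  have R: "(R has_derivative R) (at 0)"
    using linR by (simp add: linear_imp_has_derivative)
  \<comment> \<open>The composition laws for \<open>ball_act\<close> hold only inside the unit ball,
    so derivatives are compared on that neighbourhood of \<open>y0\<close>.\<close>
  have on_ball: "(f has_derivative f') (at y0)"
    if "(f2 has_derivative f') (at y0)" "\<And>y. norm y < 1 \<Longrightarrow> f y = f2 y" for f f2 :: "quat \<Rightarrow> quat" and f'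
    by (rule has_derivative_transform_within_open[OF that(1), of "ball 0 1"])
      (use y0n that(2) in auto)
  have "((\<lambda>y. ball_act g (ball_act (qmat_inv g) y)) has_derivative (\<lambda>v. P (Q v))) (at y0)"
    by (rule has_derivative_compose[OF Q]) (simp add: gy0 P)
  then have "((\<lambda>y. y) has_derivative (\<lambda>v. P (Q v))) (at y0)"
    by (rule on_ball) (simp add: g ball_act_qmat1 flip: ball_act_qmatmul)
  then have PQ: "P (Q v) = v" for v
    using has_derivative_unique[OF has_derivative_ident] by metis
  have "((\<lambda>y. R (ball_act (qmat_inv g) y)) has_derivative (\<lambda>v. R (Q v))) (at y0)"
    by (rule has_derivative_compose[OF Q]) (simp add: gy0 R)
  then have "((\<lambda>y. ball_act g (R (ball_act (qmat_inv g) y))) has_derivative (\<lambda>v. P (R (Q v)))) (at y0)"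
    by (rule has_derivative_compose) (simp add: gy0 linear_0[OF linR] P)
  then have "(ball_act M has_derivative (\<lambda>v. P (R (Q v)))) (at y0)"
  proof (rule on_ball)
    fix y :: quat assume y: "norm y < 1"
    have "ball_act M y = ball_act g (ball_act s (ball_act (qmat_inv g) y))"
      by (simp add: M ball_act_qmatmul g sSU SU11H_qmatmul norm_ball_act y)
    then show "ball_act M y = ball_act g (R (ball_act (qmat_inv g) y))"
      by (simp add: ball_act_Spin4[OF s] norm_ball_act g y R_def)
  qed
  then have D: "frechet_derivative (ball_act M) (at y0) = (\<lambda>v. P (R (Q v)))"
    by (rule frechet_derivative_at[symmetric])
  have lin1R: "linear (\<lambda>v. v - R v)" by (intro linear_compose_sub linear_ident linR)
  have "v - P (R (Q v)) = P (Q v - R (Q v))" for v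
    by (simp add: linear_diff[OF linP] PQ)
  then have "det (matrix (\<lambda>v. v - P (R (Q v)))) = det (matrix P) * (det (matrix (\<lambda>v. v - R v)) * det (matrix Q))"
    using linear_compose[OF linQ lin1R]
    by (simp add: o_def det_compose_linear[OF linP] det_compose_linear[OF lin1R linQ])
  moreover have "det (matrix P) * det (matrix Q) = 1"
    using det_compose_linear[OF linP linQ] by (simp add: PQ matrix_id[unfolded id_def])
  ultimately have "det (matrix (\<lambda>v. v - P (R (Q v)))) = det (matrix (\<lambda>v. v - R v))"
    by (simp add: algebra_simps)
  then show ?thesis
    using s unfolding D R_def by (simp add: abs_det_one_minus Spin4_def)
qed

subsection \<open>Cosets and traces\<close>

lemma trace_Psi1: "trace (Psi1 p) = complex_of_real (2 * qRe p)"
proof -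
  have UNIV_2_from_0: "(UNIV :: 2 set) = {0, 1}" using UNIV_2 by auto
  have "trace (Psi1 p) = Psi1 p $ 0 $ 0 + Psi1 p $ 1 $ 1" unfolding trace_def UNIV_2_from_0 by simp
  then show ?thesis by (simp add: Psi1_def Let_def qRe_def complex_eq_iff)
qed

lemma qRe_sandwich: "qRe (a \<odot> (p \<odot> qcnj a)) = (norm a)\<^sup>2 * qRe p"
  by (simp add: qRe_def quat_nth norm_quat, simp add: power2_eq_square algebra_simps)

text \<open>The diagonal entries of the conjugate are a p a* - b q b* and d q d* - c p c*. Real
  parts turn these into squared norms, and |c| = |b|, |d| = |a| make the difference factor.\<close>

lemma qRe_diag_difference:
  assumes "A \<in> SU11H" "D \<in> Spin4"
  shows "qRe (qmatmul A (qmatmul D (qmat_inv A)) $ 0 $ 0) - qRe (qmatmul A (qmatmul D (qmat_inv A)) $ 1 $ 1)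
    = ((norm (A$0$0))\<^sup>2 + (norm (A$0$1))\<^sup>2) * (qRe (D$0$0) - qRe (D$1$1))"
proof -
  have add: "qRe (u + v) = qRe u + qRe v" "qRe (u - v) = qRe u - qRe v" "qRe (- u) = - qRe u" for u v
    by (simp_all add: qRe_def)
  show ?thesis
    using assms(2) SU11H_rels(1,2)[OF assms(1)]
    by (simp add: Spin4_def qmat_inv_def qmul_linear qmul_assoc add qRe_sandwich)
      (simp add: algebra_simps)
qed

lemma qmat_subgroup_inv:
  assumes "qmat_subgroup S" "S \<subseteq> SU11H" "\<delta> \<in> S"
  shows "qmat_inv \<delta> \<in> S"
proof -
  obtain h where "h \<in> S" "qmatmul \<delta> h = qmat1"
    using assms(1,3) unfolding qmat_subgroup_def by blast
  moreover have "\<delta> \<in> SU11H" using assms(2,3) by blast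
  ultimately show ?thesis using qmat_inv_unique by metis
qed

lemma qcoset_refl: "qmat_subgroup S \<Longrightarrow> h \<in> qcoset S h"
  unfolding qmat_subgroup_def qcoset_def by (auto intro: exI[of _ qmat1])

lemma qcoset_translate:
  assumes S: "qmat_subgroup S" "S \<subseteq> SU11H" and d: "\<delta> \<in> S"
  shows "qcoset S (qmatmul \<delta> h) = qcoset S h"
proof -
  have sub: "qcoset S (qmatmul \<delta> h) \<subseteq> qcoset S h" if "\<delta> \<in> S" for \<delta> h
  proof
    fix a assume "a \<in> qcoset S (qmatmul \<delta> h)"
    then obtain \<gamma> where "\<gamma> \<in> S" "a = qmatmul (qmatmul \<gamma> \<delta>) h"
      by (auto simp: qcoset_def qmatmul_assoc)
    moreover from this(1) have "qmatmul \<gamma> \<delta> \<in> S"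
      using S(1) that unfolding qmat_subgroup_def by blast
    ultimately show "a \<in> qcoset S h" unfolding qcoset_def by blast
  qed
  \<comment> \<open>The reverse inclusion is \<open>sub\<close> for the inverse of \<delta>, applied
    to the coset of \<delta> h.\<close>
  have "qcoset S (qmatmul (qmat_inv \<delta>) (qmatmul \<delta> h)) \<subseteq> qcoset S (qmatmul \<delta> h)"
    by (rule sub) (rule qmat_subgroup_inv[OF S d])
  moreover have "\<delta> \<in> SU11H" using S(2) d by blast
  ultimately show ?thesis using sub[OF d] by (simp add: subset_antisym)
qed

text \<open>Moving \<delta> past f replaces it by f \<delta> f^{-1}, again in S, which the coset
  absorbs.\<close>

lemma qcoset_normalizer:
  assumes S: "qmat_subgroup S" "S \<subseteq> SU11H" and f: "qnormalizes f S" and d: "\<delta> \<in> S"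
  shows "qcoset S (qmatmul f (qmatmul \<delta> h)) = qcoset S (qmatmul f h)"
proof -
  obtain fi where fi: "qmatmul fi f = qmat1" "(\<lambda>h. qmatmul (qmatmul f h) fi) ` S = S"
    using f unfolding qnormalizes_def by blast
  have "qmatmul f (qmatmul \<delta> h) = qmatmul (qmatmul (qmatmul f \<delta>) fi) (qmatmul f h)"
  proof -
    have "qmatmul fi (qmatmul f h) = h" by (simp add: fi(1) flip: qmatmul_assoc)
    then show ?thesis by (simp only: qmatmul_assoc)
  qed
  moreover have "qmatmul (qmatmul f \<delta>) fi \<in> S" using fi(2) d by blast
  ultimately show ?thesis using qcoset_translate[OF S] by simp
qed

section \<open>Independence of the choices and evaluation of the contribution\<close>

theorem theorem7p5:
  fixes \<Gamma> :: "(real^5^5) set" and \<Gamma>h :: "qmat set"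
    and f \<Phi> :: "real^5^5" and fh \<Phi>h :: qmat and x :: "real^5"
  assumes \<Gamma>_sub: "\<Gamma> \<subseteq> SOp41" and \<Gamma>_grp: "mat_subgroup \<Gamma>"
    and \<Gamma>_disc: "discrete_set \<Gamma>" and \<Gamma>_tf: "torsion_free \<Gamma>" and M_closed: "cocompact \<Gamma>"
    and \<Gamma>h_sub: "\<Gamma>h \<subseteq> SU11H" and \<Gamma>h_grp: "qmat_subgroup \<Gamma>h"
    and \<Gamma>h_iso: "bij_betw eta \<Gamma>h \<Gamma>"
    and f: "f \<in> SOp41" "normalizes f \<Gamma>"
    and fh: "fh \<in> SU11H" "qnormalizes fh \<Gamma>h"
    and lift: "\<forall>y\<in>H4. orbit \<Gamma> (eta fh *v y) = orbit \<Gamma> (f *v y)"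
    and x: "x \<in> H4"
    and fixed: "orbit \<Gamma> (f *v x) = orbit \<Gamma> x"
    and isolated: "\<exists>e>0. \<forall>y\<in>H4. dist y x < e \<and> orbit \<Gamma> (f *v y) = orbit \<Gamma> y
                      \<longrightarrow> orbit \<Gamma> y = orbit \<Gamma> x"
    and \<Phi>: "\<Phi> \<in> SOp41" "\<forall>y\<in>H4. orbit \<Gamma> (\<Phi> *v y) = orbit \<Gamma> (f *v y)" "\<Phi> *v x = x"
    and \<Phi>h: "\<Phi>h \<in> SU11H" "eta \<Phi>h = \<Phi>"
       "\<forall>h\<in>SU11H. qcoset \<Gamma>h (qmatmul \<Phi>h h) = qcoset \<Gamma>h (qmatmul fh h)"
  shows "nu \<Gamma> \<Gamma>h fh (orbit \<Gamma> x)
           = complex_of_real (x$4 / (2 * (qRe (\<Phi>h$0$0) - qRe (\<Phi>h$1$1))))"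
proof -
  note translate = qcoset_translate[OF \<Gamma>h_grp \<Gamma>h_sub]
  note \<Gamma>h_inv = qmat_subgroup_inv[OF \<Gamma>h_grp \<Gamma>h_sub]
  have \<Gamma>h_mult: "qmatmul a b \<in> \<Gamma>h" if "a \<in> \<Gamma>h" "b \<in> \<Gamma>h" for a b
    using \<Gamma>h_grp that unfolding qmat_subgroup_def by blast
  have SU: "a \<in> SU11H" if "a \<in> \<Gamma>h" for a using that \<Gamma>h_sub by blast
  have eta_\<Gamma>: "eta \<delta> \<in> \<Gamma>" if "\<delta> \<in> \<Gamma>h" for \<delta>
    using that \<Gamma>h_iso by (auto simp: bij_betw_def)
  have lift_\<Gamma>: "\<exists>\<delta>\<in>\<Gamma>h. eta \<delta> = \<gamma>" if "\<gamma> \<in> \<Gamma>" for \<gamma>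
    using that \<Gamma>h_iso by (auto simp: bij_betw_def)
  \<comment> \<open>Freeness passes to the lifted group since \<open>eta\<close> is injective on
    \<open>\<Gamma>h\<close>; in particular -1 is excluded.\<close>
  have free: "\<delta> = qmat1" if "\<delta> \<in> \<Gamma>h" "y \<in> H4" "spin_act \<delta> y = y" for \<delta> y
  proof -
    have "eta \<delta> = mat 1"
      by (rule discrete_torsion_free_acts_freely[OF \<Gamma>_sub \<Gamma>_grp \<Gamma>_disc \<Gamma>_tf eta_\<Gamma>[OF that(1)] that(2)])
        (simp add: SU that)
    moreover have "qmat1 \<in> \<Gamma>h" using \<Gamma>h_grp by (simp add: qmat_subgroup_def)
    ultimately show ?thesis
      using that(1) \<Gamma>h_iso eta_qmat1 unfolding bij_betw_def inj_on_def by metis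
  qed

  \<comment> \<open>These names reproduce the choices inside \<open>nu\<close> literally, so that
    unfolding it at the end matches them.\<close>
  define g where "g = (SOME g. g \<in> SOp41 \<and> orbit \<Gamma> x = orbit \<Gamma> (g *v e5))"
  define gh where "gh = (SOME gh. gh \<in> SU11H \<and> eta gh = g)"
  define s' where "s' = (THE s. s \<in> Spin4 \<and> qcoset \<Gamma>h (qmatmul fh gh) = qcoset \<Gamma>h (qmatmul gh s))"
  define x' where "x' = g *v e5"
  define \<Phi>' where "\<Phi>' = (SOME \<Phi>. (\<exists>\<gamma>\<in>\<Gamma>. \<Phi> = \<gamma> ** eta fh) \<and> \<Phi> *v x' = x')"

  obtain A where A: "A \<in> SU11H" "spin_act A e5 = x" using hyperbolic_transitive[OF x] .
  have g: "g \<in> SOp41" "orbit \<Gamma> x = orbit \<Gamma> (g *v e5)"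
    using someI[of "\<lambda>g. g \<in> SOp41 \<and> orbit \<Gamma> x = orbit \<Gamma> (g *v e5)" "eta A"] A
    by (auto simp: g_def eta_SOp41)
  have gh: "gh \<in> SU11H" "eta gh = g"
    using someI_ex[of "\<lambda>gh. gh \<in> SU11H \<and> eta gh = g"] eta_surj[OF g(1)] unfolding gh_def by blast+
  have x': "x' \<in> H4" "spin_act gh e5 = x'"
    using SOp41_H4[OF g(1) e5_H4] eta_mult[OF gh(1), of e5] by (simp_all add: x'_def gh)
  have "mat 1 \<in> \<Gamma>" using \<Gamma>_grp by (simp add: mat_subgroup_def)
  moreover have "x' = mat 1 *v (g *v e5)" by (simp add: x'_def)
  ultimately have "x' \<in> orbit \<Gamma> x" unfolding g(2) unfolding orbit_def by blast
  then obtain \<gamma> where "\<gamma> \<in> \<Gamma>" "x' = \<gamma> *v x" by (auto simp: orbit_def)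
  then obtain \<delta> where \<delta>: "\<delta> \<in> \<Gamma>h" "spin_act \<delta> x = x'"
    using lift_\<Gamma> SU by (metis eta_mult)
  \<comment> \<open>The chosen \<open>gh\<close> lies over \<open>x'\<close>, which is only in the
    orbit of \<open>x\<close>; translating by the inverse of \<delta> gives a frame over
    \<open>x\<close> itself, where \<open>\<Phi>h\<close> can be conjugated into the stabilizer of
    \<open>e5\<close>.\<close>
  define k where "k = qmatmul (qmat_inv \<delta>) gh"
  have k: "k \<in> SU11H" "spin_act k e5 = x"
    using \<delta> gh SU x'(2) by (simp_all add: k_def SU11H_qmatmul spin_act_qmatmul flip: \<delta>(2))
  have gh_k: "gh = qmatmul \<delta> k" using \<delta> SU by (simp add: k_def)
  define s where "s = qmatmul (qmat_inv k) (qmatmul \<Phi>h k)"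
  have \<Phi>h_x: "spin_act \<Phi>h x = x" using \<Phi>(3) \<Phi>h eta_mult by metis
  have s: "s \<in> Spin4"
  proof (rule stabilizer_Spin4)
    show "s \<in> SU11H" using k \<Phi>h by (simp add: s_def SU11H_qmatmul)
    show "spin_act s e5 = e5"
      using k \<Phi>h \<Phi>h_x by (simp add: s_def SU11H_qmatmul spin_act_qmatmul flip: k(2))
  qed
  note s_SU = Spin4_SU11H[OF s]
  have \<Phi>h_s: "\<Phi>h = qmatmul k (qmatmul s (qmat_inv k))"
    using k by (simp add: s_def qmatmul_assoc)
  have coset: "qcoset \<Gamma>h (qmatmul fh gh) = qcoset \<Gamma>h (qmatmul gh s)"
  proof -
    have "qcoset \<Gamma>h (qmatmul gh s) = qcoset \<Gamma>h (qmatmul \<Phi>h k)"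
      using k translate[OF \<delta>(1)] by (simp add: gh_k s_def qmatmul_assoc)
    also have "\<dots> = qcoset \<Gamma>h (qmatmul fh k)" using \<Phi>h(3) k(1) by blast
    also have "\<dots> = qcoset \<Gamma>h (qmatmul fh gh)"
      unfolding gh_k by (rule qcoset_normalizer[OF \<Gamma>h_grp \<Gamma>h_sub fh(2) \<delta>(1), symmetric])
    finally show ?thesis by simp
  qed
  have e5_fix: "spin_act t e5 = e5" if "t \<in> Spin4" for t
    by (simp add: spin_act_Spin4[OF that] e5_hvec qmul_linear)

  \<comment> \<open>Two candidates for s differ by an element of \<open>\<Gamma>h\<close> that fixes
    \<open>x'\<close>, hence by the identity.\<close>
  have "s' = s"
    unfolding s'_def
  proof (rule the_equality)
    show "s \<in> Spin4 \<and> qcoset \<Gamma>h (qmatmul fh gh) = qcoset \<Gamma>h (qmatmul gh s)" using s coset by simp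
  next
    fix t assume t: "t \<in> Spin4 \<and> qcoset \<Gamma>h (qmatmul fh gh) = qcoset \<Gamma>h (qmatmul gh t)"
    then have "qmatmul gh t \<in> qcoset \<Gamma>h (qmatmul gh s)"
      using qcoset_refl[OF \<Gamma>h_grp] coset by metis
    then obtain \<epsilon> where \<epsilon>: "\<epsilon> \<in> \<Gamma>h" "qmatmul gh t = qmatmul \<epsilon> (qmatmul gh s)"
      by (auto simp: qcoset_def)
    have "spin_act (qmatmul gh t) e5 = x'" "spin_act (qmatmul gh s) e5 = x'"
      using t s gh x' by (simp_all add: spin_act_qmatmul Spin4_SU11H e5_fix)
    then have "spin_act \<epsilon> x' = x'"
      using \<epsilon> SU gh s_SU by (metis spin_act_qmatmul SU11H_qmatmul)
    then have "\<epsilon> = qmat1" using free \<epsilon>(1) x'(1) by blast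
    then have "qmatmul (qmat_inv gh) (qmatmul gh t) = qmatmul (qmat_inv gh) (qmatmul gh s)"
      using \<epsilon>(2) by simp
    then show "t = s" using gh by simp
  qed

  \<comment> \<open>This is \<open>\<Phi>h\<close> conjugated by \<delta>, that is, transported from
    the fixed point \<open>x\<close> to \<open>x'\<close>.\<close>
  define M where "M = qmatmul gh (qmatmul s (qmat_inv gh))"
  have M: "M \<in> SU11H" "spin_act M x' = x'"
    using gh s_SU x'(2) e5_fix[OF s] by (auto simp: M_def SU11H_qmatmul spin_act_qmatmul)
  obtain \<epsilon> where \<epsilon>: "\<epsilon> \<in> \<Gamma>h" "qmatmul fh gh = qmatmul \<epsilon> (qmatmul gh s)"
    using qcoset_refl[OF \<Gamma>h_grp, of "qmatmul fh gh"] unfolding coset by (auto simp: qcoset_def)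
  have fh_M: "fh = qmatmul \<epsilon> M"
  proof -
    have "fh = qmatmul (qmatmul fh gh) (qmat_inv gh)" using gh by (simp add: qmatmul_assoc)
    then show ?thesis unfolding \<epsilon>(2) by (simp add: M_def qmatmul_assoc)
  qed
  \<comment> \<open>Any two elements of the coset of \<open>eta fh\<close> fixing \<open>x'\<close>
    differ by an element of \<Gamma> fixing \<open>x'\<close>; freeness therefore determines the
    Hilbert choice.\<close>
  have \<Phi>': "\<Phi>' = eta M"
    unfolding \<Phi>'_def
  proof (rule some_equality)
    have "eta M = eta (qmat_inv \<epsilon>) ** eta fh"
      using \<epsilon> SU fh by (simp add: fh_M M SU11H_qmatmul flip: eta_qmatmul)
    moreover have "eta M *v x' = x'" using M by simp
    ultimately show "(\<exists>\<gamma>\<in>\<Gamma>. eta M = \<gamma> ** eta fh) \<and> eta M *v x' = x'"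
      using eta_\<Gamma> \<Gamma>h_inv \<epsilon>(1) by blast
  next
    fix \<Psi> assume \<Psi>: "(\<exists>\<gamma>\<in>\<Gamma>. \<Psi> = \<gamma> ** eta fh) \<and> \<Psi> *v x' = x'"
    then obtain \<delta>' where \<delta>': "\<delta>' \<in> \<Gamma>h" "\<Psi> = eta \<delta>' ** eta fh" using lift_\<Gamma> by blast
    let ?d = "qmatmul \<delta>' \<epsilon>"
    have d: "?d \<in> \<Gamma>h" using \<delta>' \<epsilon> \<Gamma>h_mult by blast
    have \<Psi>_eq: "\<Psi> = eta (qmatmul ?d M)"
      using \<delta>' \<epsilon> SU M fh by (simp add: fh_M qmatmul_assoc SU11H_qmatmul flip: eta_qmatmul)
    then have "spin_act ?d x' = x'"
      using \<Psi> M d SU by (metis SU11H_qmatmul eta_mult spin_act_qmatmul)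
    then have "?d = qmat1" using free d x'(1) by blast
    then show "\<Psi> = eta M" using \<Psi>_eq by simp
  qed
  have y0: "zeta_inv x' = ball_act gh 0"
  proof -
    have "zeta 0 = e5" by (simp add: zeta_hvec e5_hvec)
    then show ?thesis by (simp add: ball_act_def x')
  qed
  have D: "(\<lambda>y. zeta_inv (\<Phi>' *v zeta y)) = ball_act M"
    by (rule ext) (simp add: ball_act_def \<Phi>' M)
  let ?p = "qRe (s$0$0)" and ?q = "qRe (s$1$1)"
  have "nu \<Gamma> \<Gamma>h fh (orbit \<Gamma> x) = (trace (Delta_plus s') - trace (Delta_minus s'))
     / complex_of_real \<bar>det (matrix (\<lambda>v. v - frechet_derivative
         (\<lambda>y. zeta_inv (\<Phi>' *v zeta y)) (at (zeta_inv x')) v))\<bar>"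
    by (simp only: nu_def Let_def g_def gh_def s'_def x'_def \<Phi>'_def)
  also have "\<dots> = complex_of_real ((2 * ?p - 2 * ?q) / (4 * (?p - ?q)\<^sup>2))"
    unfolding D abs_det_ball_act_fixed_point[OF gh(1) s M_def y0] \<open>s' = s\<close>
      Delta_plus_def Delta_minus_def trace_Psi1 by simp
  also have "(2 * ?p - 2 * ?q) / (4 * (?p - ?q)\<^sup>2) = 1 / (2 * (?p - ?q))"
  proof -
    \<comment> \<open>At d = 0 both sides are 0, since division by zero yields 0.\<close>
    have "2 * d / (4 * d\<^sup>2) = 1 / (2 * d)" for d :: real
      by (cases "d = 0") (simp_all add: power2_eq_square)
    then show ?thesis by (simp only: flip: right_diff_distrib)
  qed
  \<comment> \<open>Expanding by x_5 > 0 produces the factor that relates the real parts for s to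
    those for its conjugate \<open>\<Phi>h\<close>.\<close>
  also have "\<dots> = x$4 / (2 * (x$4 * (?p - ?q)))"
    using x by (simp add: H4_qpart)
  also have "x$4 * (?p - ?q) = qRe (\<Phi>h$0$0) - qRe (\<Phi>h$1$1)"
  proof -
    have "x$4 = (norm (k$0$0))\<^sup>2 + (norm (k$0$1))\<^sup>2"
      unfolding k(2)[symmetric] by (simp add: spin_act_def qmul_linear)
    then show ?thesis using qRe_diag_difference[OF k(1) s] by (simp only: \<Phi>h_s)
  qed
  finally show ?thesis .
qed

end
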